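(* Let $0<\alpha<1$, let $\mathbf{x}=(x_1,\dots,x_N)\in\mathbb{R}^N$ be nonzero, let $s_{ij}$ ($1\le i\le N$, $1\le j\le M$) be i.i.d. $S(\alpha,1)$ random variables, and let $y_j=\sum_{i=1}^N x_is_{ij}$. Let $\epsilon>0$, $\theta=\left(\sum_{i=1}^N|x_i|^\alpha\right)^{1/\alpha}$ and $\psi=(\epsilon/\theta)^{\alpha/(1-\alpha)}$, and assume $\psi\le 1/3$. For each $i$ define the absolute minimum estimator $\hat x_{i,min}=y_t/s_{it}$, where $t=\arg\min_{1\le j\le M}|y_j/s_{ij}|$. Then for every coordinate $i$ with $x_i=0$, $$\Pr\left(|\hat x_{i,min}|>\epsilon\right)\le \frac{1}{(1+\psi)^M}.$$
   Context: A random variable $Z$ has the symmetric $\alpha$-stable distribution with unit scale, $S(\alpha,1)$, if its characteristic function is $E e^{\sqrt{-1}Zt}=e^{-|t|^\alpha}$. *)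

theory Defs
  imports "HOL-Probability.Probability"
begin

definition sym_stable :: "real \<Rightarrow> real measure \<Rightarrow> bool" where
  "sym_stable \<alpha> \<mu> \<longleftrightarrow> (\<forall>t. char \<mu> t = complex_of_real (exp (- (\<bar>t\<bar> powr \<alpha>))))"

definition meas :: "(nat \<Rightarrow> real) \<Rightarrow> (nat \<Rightarrow> nat \<Rightarrow> 'a \<Rightarrow> real) \<Rightarrow> nat \<Rightarrow> nat \<Rightarrow> 'a \<Rightarrow> real" where
  "meas x s N j \<omega> = (\<Sum>k<N. x k * s k j \<omega>)"

definition argmin_idx :: "(nat \<Rightarrow> real) \<Rightarrow> (nat \<Rightarrow> nat \<Rightarrow> 'a \<Rightarrow> real) \<Rightarrow> nat \<Rightarrow> nat \<Rightarrow> nat \<Rightarrow> 'a \<Rightarrow> nat" where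
  "argmin_idx x s N M i \<omega> =
     (LEAST j. j < M \<and> (\<forall>k<M. \<bar>meas x s N j \<omega> / s i j \<omega>\<bar> \<le> \<bar>meas x s N k \<omega> / s i k \<omega>\<bar>))"

definition xhat_min :: "(nat \<Rightarrow> real) \<Rightarrow> (nat \<Rightarrow> nat \<Rightarrow> 'a \<Rightarrow> real) \<Rightarrow> nat \<Rightarrow> nat \<Rightarrow> nat \<Rightarrow> 'a \<Rightarrow> real" where
  "xhat_min x s N M i \<omega> =
     (let t = argmin_idx x s N M i \<omega> in meas x s N t \<omega> / s i t \<omega>)"

end

theory Submission
  imports Defs "HOL-Complex_Analysis.Conformal_Mappings" "HOL-Real_Asymp.Real_Asymp"
begin

text \<open>
  Since \<open>x\<^sub>i = 0\<close>, the variables \<open>y\<^sub>j / \<theta>\<close> and \<open>s\<^sub>i\<^sub>j\<close> are independent \<open>S(\<alpha>,1)\<close> variables, and everything is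
  independent over \<open>j\<close>. So it suffices to show \<open>P(|S\<^sub>2| \<le> \<delta> |S\<^sub>1|) \<ge> \<psi> / (1 + \<psi>)\<close> for \<open>\<delta> = \<epsilon> / \<theta> \<le> 1\<close>.

  Put \<open>\<beta> = \<alpha>/2\<close>. Then \<open>S = (2A)\<^bsup>1/2\<^esup> G\<close> in law, with \<open>G\<close> standard normal and \<open>A\<close> positive \<open>\<beta>\<close>-stable, i.e.
  \<open>E exp (- \<lambda>A) = exp (- \<lambda>\<^bsup>\<beta>\<^esup>)\<close>. The ratio \<open>\<rho> = A\<^sub>2/A\<^sub>1\<close> satisfies \<open>E (y / (\<rho> + y)) = y\<^bsup>\<beta>\<^esup> / (1 + y\<^bsup>\<beta>\<^esup>)\<close>; by analytic
  continuation to \<open>-y\<close> this gives \<open>P(\<rho> \<le> y) \<ge> \<Theta>(y\<^bsup>\<beta>\<^esup>) / (\<pi>\<beta>)\<close> with the angle \<open>\<Theta>(X) = arg (1 + X e\<^bsup>i\<pi>\<beta>\<^esup>)\<close>.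
  Conditionally on \<open>k = (G\<^sub>1/G\<^sub>2)\<^sup>2\<close> the event is \<open>\<rho> \<le> \<delta>\<^sup>2 k\<close>, and \<open>k\<close> has the same law as \<open>1/k\<close>. The claim
  follows from \<open>\<Theta>(Xk) + \<Theta>(X/k) \<ge> 2 \<Theta>(X)\<close> for \<open>X \<le> 1\<close> and \<open>\<Theta>(\<delta>\<^bsup>\<alpha>\<^esup>) \<ge> \<pi>\<beta> \<psi> / (1 + \<psi>)\<close>.
\<close>

subsection \<open>Two inequalities for angles\<close>

lemma two_mult_div_pi_le_sin:
  fixes y :: real
  assumes "0 \<le> y" "y \<le> pi / 2"
  shows "2 * y / pi \<le> sin y"
proof -
  have "convex_on {0..pi} (\<lambda>x. - sin x)"
    by (rule f''_ge0_imp_convex[where f' = "\<lambda>x. - cos x" and f'' = sin])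
       (auto intro!: derivative_eq_intros sin_ge_zero)
  then have "- sin ((1 - 2 * y / pi) *\<^sub>R 0 + (2 * y / pi) *\<^sub>R (pi / 2))
      \<le> (1 - 2 * y / pi) * - sin 0 + (2 * y / pi) * - sin (pi / 2)"
    using assms by (intro convex_onD) (auto simp: field_simps)
  then show ?thesis
    by simp
qed

lemma one_minus_mult_sin_le_mult_cos:
  fixes y :: real
  assumes "0 \<le> y" "y \<le> pi / 2"
  shows "(1 - 2 * y / pi) * sin y \<le> y * cos y"
proof -
  have "(1 - 2 * y / pi) * sin y \<le> (1 - 2 * y / pi) * y"
    using assms by (intro mult_left_mono sin_x_le_x) (auto simp: field_simps)
  also have "\<dots> = y * (2 * (pi / 2 - y) / pi)"
    by (simp add: field_simps)
  also have "\<dots> \<le> y * sin (pi / 2 - y)"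
    using assms by (intro mult_left_mono two_mult_div_pi_le_sin) auto
  finally show ?thesis
    by (simp add: sin_diff)
qed

lemma sin_powr_mono:
  fixes c u v :: real
  assumes c_range: "0 < c" "c < pi / 2" and uv_order: "0 < u" "u \<le> v" "v \<le> 1"
  shows "sin (c * u) * v powr (1 - 2 * c / pi) \<le> sin (c * v) * u powr (1 - 2 * c / pi)"
proof -
  define q where "q = 1 - 2 * c / pi"
  have arg_range: "0 < c * w" "c * w < pi / 2" "0 < sin (c * w)" if "u \<le> w" "w \<le> v" for w
  proof -
    show "0 < c * w" using that c_range uv_order by simp
    have "c * w \<le> c * 1" using that c_range uv_order by (intro mult_left_mono) auto
    then show "c * w < pi / 2" using c_range by linarith
    with \<open>0 < c * w\<close> show "0 < sin (c * w)" by (intro sin_gt_zero) auto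
  qed
  have "ln (sin (c * u)) - q * ln u \<le> ln (sin (c * v)) - q * ln v"
  proof (rule DERIV_nonneg_imp_nondecreasing[OF uv_order(2)])
    fix w assume w_range: "u \<le> w" "w \<le> v"
    note arg_range_w = arg_range[OF w_range]
    have "0 < w" using w_range uv_order by simp
    have "q * sin (c * w) \<le> (1 - 2 * (c * w) / pi) * sin (c * w)"
      using w_range uv_order c_range arg_range_w by (intro mult_right_mono) (auto simp: q_def field_simps)
    also have "\<dots> \<le> c * w * cos (c * w)"
      using arg_range_w by (intro one_minus_mult_sin_le_mult_cos) auto
    finally have "0 \<le> c * cos (c * w) / sin (c * w) - q / w"
      using arg_range_w \<open>0 < w\<close> by (simp add: field_simps)
    moreover have "((\<lambda>w. ln (sin (c * w)) - q * ln w) has_real_derivative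
        c * cos (c * w) / sin (c * w) - q / w) (at w)"
      using arg_range_w \<open>0 < w\<close> by (auto intro!: derivative_eq_intros simp: field_simps)
    ultimately show "\<exists>d. ((\<lambda>w. ln (sin (c * w)) - q * ln w) has_real_derivative d) (at w) \<and> 0 \<le> d"
      by blast
  qed
  then have "ln (sin (c * u) * v powr q) \<le> ln (sin (c * v) * u powr q)"
    using arg_range[of u] arg_range[of v] uv_order by (simp add: ln_mult ln_powr)
  then show ?thesis
    using arg_range[of u] arg_range[of v] uv_order by (simp add: q_def)
qed

definition sector_angle :: "real \<Rightarrow> real \<Rightarrow> real" where
  "sector_angle c X = Arg (1 + of_real X * cis c)"

lemma of_real_mult_cis_not_nonpos_Real:
  assumes "0 < X" "\<bar>c\<bar> < pi"
  shows "of_real X * cis c \<notin> \<real>\<^sub>\<le>\<^sub>0"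
  using assms sin_zero_pi_iff[of c] by (auto simp: complex_nonpos_Reals_iff)

lemma of_real_add_not_nonpos_Real:
  fixes z :: complex
  assumes "0 \<le> r" "z \<notin> \<real>\<^sub>\<le>\<^sub>0"
  shows "of_real r + z \<notin> \<real>\<^sub>\<le>\<^sub>0"
  using assms by (auto simp: complex_nonpos_Reals_iff)

lemma one_plus_cis_not_nonpos_Real:
  assumes "\<bar>c\<bar> < pi" "0 \<le> X"
  shows "1 + of_real X * cis c \<notin> \<real>\<^sub>\<le>\<^sub>0"
  using of_real_add_not_nonpos_Real[of 1 "of_real X * cis c"] of_real_mult_cis_not_nonpos_Real[of X c] assms
  by (cases "X = 0") auto

lemma sector_angle_eq_arctan:
  assumes "\<bar>c\<bar> < pi / 2" "0 \<le> X"
  shows "sector_angle c X = arctan (X * sin c / (1 + X * cos c))"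
proof -
  have "0 < cos c" using assms by (intro cos_gt_zero_pi) auto
  with assms(2) have "0 < 1 + X * cos c" by (intro add_pos_nonneg) auto
  then show ?thesis
    unfolding sector_angle_def by (subst arg_conv_arctan) auto
qed

lemma le_sector_angle:
  assumes c_range: "0 < c" "c < pi / 2" and t_range: "0 < t" "t \<le> 1"
  shows "c * (t / (1 + t)) \<le> sector_angle c (t powr (1 - 2 * c / pi))"
proof -
  define v where "v = t / (1 + t)"
  define X where "X = t powr (1 - 2 * c / pi)"
  have v_props: "0 < v" "v \<le> 1 - v" "v < 1" "1 - v \<le> 1" and t_eq: "t = v / (1 - v)"
    using t_range by (auto simp: v_def field_simps mult_le_one)
  have X_props: "X = v powr (1 - 2 * c / pi) / (1 - v) powr (1 - 2 * c / pi)" "0 < X"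
    using v_props by (auto simp: X_def t_eq powr_divide)
  have "sin (c * v) \<le> X * sin (c * (1 - v))"
    using sin_powr_mono[OF c_range v_props(1,2,4)] v_props
    by (simp add: X_props pos_le_divide_eq mult.commute)
  also have "sin (c * (1 - v)) = sin c * cos (c * v) - cos c * sin (c * v)"
    by (simp add: right_diff_distrib sin_diff)
  finally have sin_le: "sin (c * v) * (1 + X * cos c) \<le> X * sin c * cos (c * v)"
    by (simp add: algebra_simps)
  have "c * v \<le> c * 1" using c_range v_props by (intro mult_left_mono) auto
  then have "c * v < pi / 2" using c_range by linarith
  with c_range v_props have cv_range: "0 < c * v" "c * v < pi / 2" by simp_all
  have "0 < cos (c * v)" "0 < 1 + X * cos c"
    using cv_range c_range X_props(2) by (auto intro!: cos_gt_zero_pi add_pos_pos mult_pos_pos)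
  with sin_le have "tan (c * v) \<le> X * sin c / (1 + X * cos c)"
    by (simp add: tan_def field_simps)
  then have "arctan (tan (c * v)) \<le> sector_angle c X"
    using c_range X_props(2) by (subst sector_angle_eq_arctan) (auto intro: arctan_monotone')
  then show ?thesis
    using cv_range by (simp add: arctan_tan v_def X_def)
qed

lemma norm_one_plus_cis_squared:
  "(norm (1 + of_real X * cis c))\<^sup>2 = 1 + 2 * X * cos c + X\<^sup>2"
proof -
  have "(1 + X * cos c)\<^sup>2 + (X * sin c)\<^sup>2 = 1 + 2 * X * cos c + X\<^sup>2"
    using sin_cos_squared_add[of c] by algebra
  then show ?thesis
    by (simp add: cmod_power2)
qed

lemma sector_angle_has_real_derivative:
  assumes "\<bar>c\<bar> < pi" "0 < X"
  shows "(sector_angle c has_real_derivative sin c / (1 + 2 * X * cos c + X\<^sup>2)) (at X)"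
proof (rule has_field_derivative_transform_within_open[where S = "{0<..}"])
  let ?z = "1 + of_real X * cis c"
  have slit: "1 + of_real Y * cis c \<notin> \<real>\<^sub>\<le>\<^sub>0" if "0 < Y" for Y
    using one_plus_cis_not_nonpos_Real[of c Y] assms(1) that by simp
  have "((\<lambda>w. Ln (1 + w * cis c)) has_field_derivative cis c / ?z) (at (of_real X))"
    using slit[OF assms(2)] by (auto intro!: derivative_eq_intros simp: field_simps)
  then have "((\<lambda>Y. Im (Ln (1 + of_real Y * cis c))) has_real_derivative Im (cis c / ?z)) (at X)"
    by (intro has_field_derivative_Im has_vector_derivative_real_field)
  also have "Im (cis c / ?z) = sin c / (norm ?z)\<^sup>2"
    by (simp add: Im_divide cmod_power2 algebra_simps)
  finally show "((\<lambda>Y. Im (Ln (1 + of_real Y * cis c))) has_real_derivative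
      sin c / (1 + 2 * X * cos c + X\<^sup>2)) (at X)"
    unfolding norm_one_plus_cis_squared .
  show "Im (Ln (1 + of_real Y * cis c)) = sector_angle c Y" if "Y \<in> {0<..}" for Y
    using slit[of Y] that unfolding sector_angle_def by (subst Arg_eq_Im_Ln) auto
qed (use assms in auto)

lemma sector_angle_scale_has_nonneg_derivative:
  assumes c_range: "0 \<le> c" "c < pi" and X_range: "0 < X" "X \<le> 1" and w_ge_1: "1 \<le> w"
  shows "\<exists>d. ((\<lambda>k. sector_angle c (X * k) + sector_angle c (X / k)) has_real_derivative d) (at w) \<and> 0 \<le> d"
proof -
  let ?D = "\<lambda>Y. sin c / (1 + 2 * Y * cos c + Y\<^sup>2)"
  have pos: "0 < 1 + 2 * Y * cos c + Y\<^sup>2" if "0 \<le> Y" for Y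
    using one_plus_cis_not_nonpos_Real[of c Y] c_range that
    unfolding norm_one_plus_cis_squared[symmetric] by (auto simp: zero_less_power2)
  have deriv: "(sector_angle c has_real_derivative ?D Y) (at Y)" if "0 < Y" for Y
    using c_range that by (intro sector_angle_has_real_derivative) auto
  have "((\<lambda>k. sector_angle c (X * k)) has_real_derivative ?D (X * w) * X) (at w)"
    by (rule DERIV_chain2[OF deriv]) (use X_range w_ge_1 in \<open>auto intro!: derivative_eq_intros\<close>)
  moreover have "((\<lambda>k. sector_angle c (X / k)) has_real_derivative ?D (X / w) * (- X / w\<^sup>2)) (at w)"
    by (rule DERIV_chain2[OF deriv])
       (use X_range w_ge_1 in \<open>auto intro!: derivative_eq_intros simp: power2_eq_square\<close>)
  moreover have "0 \<le> ?D (X * w) * X + ?D (X / w) * (- X / w\<^sup>2)"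
  proof -
    have scaled: "(1 + 2 * (X / w) * cos c + (X / w)\<^sup>2) * w\<^sup>2 = w\<^sup>2 + 2 * X * w * cos c + X\<^sup>2"
      using w_ge_1 by (simp add: field_simps power2_eq_square)
    have "0 \<le> (w\<^sup>2 - 1) * (1 - X\<^sup>2)"
      using X_range w_ge_1 by (intro mult_nonneg_nonneg) (auto simp: power_le_one)
    then have "1 + 2 * (X * w) * cos c + (X * w)\<^sup>2 \<le> w\<^sup>2 + 2 * X * w * cos c + X\<^sup>2"
      by (simp add: algebra_simps power_mult_distrib)
    then have "?D (X / w) / w\<^sup>2 \<le> ?D (X * w)"
      unfolding divide_divide_eq_left scaled
      using c_range pos[of "X * w"] X_range w_ge_1
      by (intro divide_left_mono) (auto intro!: sin_ge_zero mult_pos_pos)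
    then have "0 \<le> X * (?D (X * w) - ?D (X / w) / w\<^sup>2)"
      using X_range by simp
    then show ?thesis
      by (simp add: algebra_simps)
  qed
  ultimately show ?thesis
    using DERIV_add by blast
qed

lemma sector_angle_scale_ge:
  assumes c_range: "0 \<le> c" "c < pi" and X_range: "0 < X" "X \<le> 1" and k_pos: "0 < k"
  shows "2 * sector_angle c X \<le> sector_angle c (X * k) + sector_angle c (X / k)"
proof -
  have ge_one: "2 * sector_angle c X \<le> sector_angle c (X * k) + sector_angle c (X / k)" if "1 \<le> k" for k
    using DERIV_nonneg_imp_nondecreasing[OF that sector_angle_scale_has_nonneg_derivative[OF c_range X_range]]
    by simp
  show ?thesis
  proof (cases "1 \<le> k")
    case False
    with k_pos have "1 \<le> 1 / k" by simp
    from ge_one[OF this] show ?thesis by simp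
  qed (rule ge_one)
qed

subsection \<open>Stieltjes inversion\<close>

lemma norm_difference_quotient_le:
  fixes f :: "'a::real_normed_field \<Rightarrow> 'a"
  assumes "convex S" "w \<in> S" "z \<in> S" "w \<noteq> z"
    and "\<forall>w\<in>S. (f has_field_derivative f' w) (at w)" "\<forall>w\<in>S. norm (f' w) \<le> B"
  shows "norm ((f w - f z) / (w - z)) \<le> B"
proof -
  have "norm (f w - f z) \<le> B * norm (w - z)"
    using assms by (intro field_differentiable_bound[of S]) (auto intro: has_field_derivative_at_within)
  then show ?thesis
    using assms(4) by (simp add: norm_divide field_simps)
qed

lemma has_field_derivative_integral:
  fixes f :: "'b::{real_normed_field,banach,second_countable_topology} \<Rightarrow> 'a \<Rightarrow> 'b"
  assumes S_domain: "open S" "convex S" "z \<in> S"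
    and integrable_f: "\<And>w. w \<in> S \<Longrightarrow> integrable M (f w)"
    and measurable_f': "f' z \<in> borel_measurable M" and integrable_B: "integrable M B"
    and deriv: "AE x in M. \<forall>w\<in>S. ((\<lambda>w. f w x) has_field_derivative f' w x) (at w)"
    and bound: "AE x in M. \<forall>w\<in>S. norm (f' w x) \<le> B x"
  shows "((\<lambda>w. \<integral>x. f w x \<partial>M) has_field_derivative (\<integral>x. f' z x \<partial>M)) (at z)"
proof -
  have "((\<lambda>w. ((\<integral>x. f w x \<partial>M) - (\<integral>x. f z x \<partial>M)) / (w - z)) \<longlongrightarrow> (\<integral>x. f' z x \<partial>M)) (at z within S)"
    unfolding tendsto_at_iff_sequentially
  proof (intro allI impI)
    fix X assume X_seq: "\<forall>i. X i \<in> S - {z}" "X \<longlonglongrightarrow> z"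
    then have X_in: "X i \<in> S" "X i \<noteq> z" for i by auto
    let ?q = "\<lambda>i x. (f (X i) x - f z x) / (X i - z)"
    have "(\<lambda>i. \<integral>x. ?q i x \<partial>M) \<longlonglongrightarrow> (\<integral>x. f' z x \<partial>M)"
    proof (rule integral_dominated_convergence[where w = B])
      show "?q i \<in> borel_measurable M" for i
        using integrable_f[OF X_in(1)[of i]] integrable_f[OF S_domain(3)] by measurable
      show "AE x in M. (\<lambda>i. ?q i x) \<longlonglongrightarrow> f' z x"
        using deriv
      proof eventually_elim
        case (elim x)
        with S_domain(3) have "((\<lambda>w. (f w x - f z x) / (w - z)) \<longlongrightarrow> f' z x) (at z)"
          by (simp add: has_field_derivative_iff)
        then show ?case
          unfolding tendsto_at_iff_sequentially comp_def using X_seq by auto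
      qed
      show "AE x in M. norm (?q i x) \<le> B x" for i
        using deriv bound
        by eventually_elim (rule norm_difference_quotient_le[OF S_domain(2) X_in(1) S_domain(3) X_in(2)])
    qed (fact measurable_f' integrable_B)+
    moreover have "(\<integral>x. ?q i x \<partial>M) = ((\<integral>x. f (X i) x \<partial>M) - (\<integral>x. f z x \<partial>M)) / (X i - z)" for i
      using integrable_f[OF X_in(1)[of i]] integrable_f[OF S_domain(3)] by simp
    ultimately show "((\<lambda>w. ((\<integral>x. f w x \<partial>M) - (\<integral>x. f z x \<partial>M)) / (w - z)) \<circ> X) \<longlonglongrightarrow> (\<integral>x. f' z x \<partial>M)"
      by (simp only: comp_def)
  qed
  then show ?thesis
    unfolding has_field_derivative_iff at_within_open[OF S_domain(3,1)] .
qed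

lemma has_field_derivative_Ln_of_real_add:
  fixes z :: complex
  assumes "0 \<le> r" "z \<notin> \<real>\<^sub>\<le>\<^sub>0"
  shows "((\<lambda>z. Ln (of_real r + z)) has_field_derivative 1 / (of_real r + z)) (at z)"
  using of_real_add_not_nonpos_Real[OF assms] by (auto intro!: derivative_eq_intros simp: inverse_eq_divide)

lemma norm_inverse_of_real_add_le:
  fixes z :: complex
  assumes "0 < d" "d \<le> dist z (- of_real r)"
  shows "norm (1 / (of_real r + z)) \<le> 1 / d"
  using assms by (simp add: norm_divide dist_norm add.commute frac_le)

definition (in prob_space) log_transform :: "('a \<Rightarrow> real) \<Rightarrow> complex \<Rightarrow> complex" where
  "log_transform r z = expectation (\<lambda>x. Ln (of_real (r x) + z) - Ln (of_real (r x) + 1))"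

lemma closed_segment_one_slit:
  fixes z :: complex
  assumes "z \<notin> \<real>\<^sub>\<le>\<^sub>0"
  shows "closed_segment 1 z \<subseteq> - \<real>\<^sub>\<le>\<^sub>0"
proof
  fix w assume "w \<in> closed_segment 1 z"
  then obtain u where u_range: "0 \<le> u" "u \<le> 1" and w_eq: "w = (1 - u) *\<^sub>R 1 + u *\<^sub>R z"
    by (auto simp: in_segment)
  show "w \<in> - \<real>\<^sub>\<le>\<^sub>0"
  proof
    assume "w \<in> \<real>\<^sub>\<le>\<^sub>0"
    then have nonpos: "1 - u + u * Re z \<le> 0" "u * Im z = 0"
      by (auto simp: w_eq complex_nonpos_Reals_iff)
    with u_range have "u \<noteq> 0" by auto
    with nonpos u_range have "u * Re z \<le> 0" "0 < u" "Im z = 0" by auto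
    with assms show False
      by (auto simp: complex_nonpos_Reals_iff mult_le_0_iff)
  qed
qed

lemma (in prob_space) integrable_log_transform:
  assumes [measurable]: "random_variable borel r" and r_nonneg: "AE x in M. 0 \<le> r x"
    and z_slit: "z \<notin> \<real>\<^sub>\<le>\<^sub>0"
  shows "integrable M (\<lambda>x. Ln (of_real (r x) + z) - Ln (of_real (r x) + 1))"
proof -
  have "closed_segment 1 z \<inter> \<real>\<^sub>\<le>\<^sub>0 = {}"
    using closed_segment_one_slit[OF z_slit] by auto
  from separate_compact_closed[OF compact_segment closed_nonpos_Reals_complex this]
  obtain d where d_separates: "0 < d" "\<And>v w. v \<in> closed_segment 1 z \<Longrightarrow> w \<in> \<real>\<^sub>\<le>\<^sub>0 \<Longrightarrow> d \<le> dist v w"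
    by auto
  have "norm (Ln (of_real r + z) - Ln (of_real r + 1)) \<le> 1 / d * norm (z - 1)" if "0 \<le> r" for r
  proof (rule field_differentiable_bound[OF convex_closed_segment])
    fix w assume w_in_segment: "w \<in> closed_segment 1 z"
    show "((\<lambda>w. Ln (of_real r + w)) has_field_derivative 1 / (of_real r + w)) (at w within closed_segment 1 z)"
      using closed_segment_one_slit[OF z_slit] w_in_segment
      by (intro has_field_derivative_Ln_of_real_add[THEN has_field_derivative_at_within] that) auto
    show "norm (1 / (of_real r + w)) \<le> 1 / d"
      using that
      by (intro norm_inverse_of_real_add_le d_separates w_in_segment) (auto simp: complex_nonpos_Reals_iff)
  qed auto
  with r_nonneg have "AE x in M. norm (Ln (of_real (r x) + z) - Ln (of_real (r x) + 1)) \<le> 1 / d * norm (z - 1)"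
    by (auto elim: eventually_mono)
  then show ?thesis
    by (intro integrable_const_bound) auto
qed

lemma (in prob_space) has_field_derivative_log_transform:
  assumes [measurable]: "random_variable borel r" and r_nonneg: "AE x in M. 0 \<le> r x"
    and z_slit: "z \<notin> \<real>\<^sub>\<le>\<^sub>0"
  shows "(log_transform r has_field_derivative expectation (\<lambda>x. 1 / (of_real (r x) + z))) (at z)"
proof -
  have "open (- \<real>\<^sub>\<le>\<^sub>0 :: complex set)" by (simp add: open_Compl)
  with z_slit obtain d where ball_d: "0 < d" "ball z d \<subseteq> - \<real>\<^sub>\<le>\<^sub>0"
    by (auto simp: open_contains_ball)
  let ?S = "ball z (d / 2)"
  have slit: "w \<notin> \<real>\<^sub>\<le>\<^sub>0" if "w \<in> ?S" for w
  proof -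
    have "w \<in> ball z d" using that ball_d(1) by simp
    with ball_d(2) show ?thesis by blast
  qed
  have deriv: "((\<lambda>w. Ln (of_real r + w) - Ln (of_real r + 1)) has_field_derivative 1 / (of_real r + w)) (at w)"
    if "0 \<le> r" "w \<in> ?S" for r w
    using DERIV_diff[OF has_field_derivative_Ln_of_real_add[OF that(1) slit[OF that(2)]] DERIV_const]
    by simp
  have bound: "norm (1 / (of_real r + w)) \<le> 1 / (d / 2)" if "0 \<le> r" "w \<in> ?S" for r w
  proof (rule norm_inverse_of_real_add_le)
    have "- of_real r \<notin> ball z d"
      using that(1) ball_d(2) by (auto simp: complex_nonpos_Reals_iff)
    then show "d / 2 \<le> dist w (- of_real r)"
      using dist_triangle[of z "- of_real r" w] that(2) by simp
  qed (use that ball_d in auto)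
  show ?thesis
    unfolding log_transform_def[abs_def]
  proof (rule has_field_derivative_integral[where S = ?S and B = "\<lambda>_. 1 / (d / 2)"])
    show "integrable M (\<lambda>x. Ln (of_real (r x) + w) - Ln (of_real (r x) + 1))" if "w \<in> ?S" for w
      by (intro integrable_log_transform r_nonneg slit[OF that]) simp
  qed (use ball_d r_nonneg deriv bound in \<open>auto elim!: eventually_mono\<close>)
qed

lemma one_islimpt_pos_Reals: "1 islimpt complex_of_real ` {0<..}"
  unfolding islimpt_approachable
proof (intro allI impI)
  fix e :: real assume "0 < e"
  moreover from this have "complex_of_real (1 + e / 2) \<in> complex_of_real ` {0<..}"
    by (intro imageI) simp
  ultimately have "complex_of_real (1 + e / 2) \<in> complex_of_real ` {0<..} \<and> complex_of_real (1 + e / 2) \<noteq> 1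
      \<and> dist (complex_of_real (1 + e / 2)) 1 < e"
    by (simp add: dist_norm norm_divide)
  then show "\<exists>w\<in>complex_of_real ` {0<..}. w \<noteq> 1 \<and> dist w 1 < e" by blast
qed

lemma slit_plane_eq_zeroI:
  fixes f f' :: "complex \<Rightarrow> complex"
  assumes deriv: "\<And>z. z \<notin> \<real>\<^sub>\<le>\<^sub>0 \<Longrightarrow> (f has_field_derivative f' z) (at z)"
    and "\<And>y::real. 0 < y \<Longrightarrow> f' (of_real y) = 0" and "f 1 = 0" and "z \<notin> \<real>\<^sub>\<le>\<^sub>0"
  shows "f z = 0"
proof -
  let ?S = "- \<real>\<^sub>\<le>\<^sub>0 :: complex set" and ?U = "complex_of_real ` {0<..}"
  have "((\<lambda>y. f (of_real y)) has_vector_derivative 0) (at y within {0<..})" if "0 < y" for y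
    using has_vector_derivative_real_field[OF deriv[of "of_real y"]] assms(2)[OF that] that
    by (auto simp: complex_nonpos_Reals_iff)
  then obtain k where "\<And>y. 0 < y \<Longrightarrow> f (of_real y) = k"
    using has_vector_derivative_zero_constant[of "{0<..}" "\<lambda>y. f (of_real y)"] by auto
  then have zero: "f w = 0" if "w \<in> ?U" for w
    using \<open>f 1 = 0\<close> that by (metis imageE greaterThan_iff of_real_1 zero_less_one)
  have "starlike ?S"
    unfolding starlike_def
    by (intro bexI[of _ 1] ballI closed_segment_one_slit) (auto simp: complex_nonpos_Reals_iff)
  moreover have "open ?S" by (simp add: open_Compl)
  moreover have "f holomorphic_on ?S"
    using deriv by (auto simp: holomorphic_on_open[OF \<open>open ?S\<close>])
  ultimately show ?thesis
    using zero assms(4) one_islimpt_pos_Reals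
    by (intro analytic_continuation[of f ?S ?U 1 z])
       (auto simp: starlike_imp_connected complex_nonpos_Reals_iff)
qed

lemma powr_of_real_eq_polar:
  fixes z :: complex
  assumes "z \<noteq> 0"
  shows "z powr of_real \<beta> = of_real (norm z powr \<beta>) * cis (\<beta> * Arg z)"
  using assms
  by (simp add: powr_def Ln_Arg exp_add distrib_left cis_conv_exp mult_ac exp_of_real[symmetric])

lemma one_plus_powr_not_nonpos_Real:
  fixes z :: complex
  assumes "z \<notin> \<real>\<^sub>\<le>\<^sub>0" "0 < \<beta>" "\<beta> < 1"
  shows "1 + z powr of_real \<beta> \<notin> \<real>\<^sub>\<le>\<^sub>0"
proof -
  have "\<beta> * \<bar>Arg z\<bar> \<le> \<beta> * pi"
    using assms mpi_less_Arg[of z] Arg_le_pi[of z] by (intro mult_left_mono) auto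
  also have "\<dots> < pi" using assms by simp
  finally have "\<bar>\<beta> * Arg z\<bar> < pi" using assms by (simp add: abs_mult)
  moreover have "z \<noteq> 0" using assms(1) by auto
  ultimately show ?thesis
    using one_plus_cis_not_nonpos_Real by (simp add: powr_of_real_eq_polar)
qed

lemma (in prob_space) log_transform_eq:
  assumes \<beta>_range: "0 < \<beta>" "\<beta> < 1"
    and [measurable]: "random_variable borel r" and r_nonneg: "AE x in M. 0 \<le> r x"
    and stieltjes: "\<And>y. 0 < y \<Longrightarrow> expectation (\<lambda>x. y / (r x + y)) = y powr \<beta> / (1 + y powr \<beta>)"
    and z_slit: "z \<notin> \<real>\<^sub>\<le>\<^sub>0"
  shows "log_transform r z = (Ln (1 + z powr of_real \<beta>) - Ln 2) / of_real \<beta>"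
proof -
  let ?L = "\<lambda>z :: complex. (Ln (1 + z powr of_real \<beta>) - Ln 2) / of_real \<beta>"
  let ?L' = "\<lambda>z :: complex. z powr (of_real \<beta> - 1) / (1 + z powr of_real \<beta>)"
  let ?S = "\<lambda>z :: complex. expectation (\<lambda>x. 1 / (of_real (r x) + z))"
  have "log_transform r z - ?L z = 0"
  proof (rule slit_plane_eq_zeroI[where f = "\<lambda>z. log_transform r z - ?L z" and f' = "\<lambda>z. ?S z - ?L' z"])
    fix z :: complex assume z_slit: "z \<notin> \<real>\<^sub>\<le>\<^sub>0"
    then have "((\<lambda>z. 1 + z powr of_real \<beta>) has_field_derivative of_real \<beta> * z powr (of_real \<beta> - 1)) (at z)"
      by (auto intro!: derivative_eq_intros has_field_derivative_powr)
    from DERIV_chain2[OF has_field_derivative_Ln[OF one_plus_powr_not_nonpos_Real[OF z_slit \<beta>_range]] this]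
    have "(?L has_field_derivative
        (inverse (1 + z powr of_real \<beta>) * (of_real \<beta> * z powr (of_real \<beta> - 1)) - 0) / of_real \<beta>) (at z)"
      by (intro DERIV_cdivide DERIV_diff DERIV_const)
    also have "(inverse (1 + z powr of_real \<beta>) * (of_real \<beta> * z powr (of_real \<beta> - 1)) - 0) / of_real \<beta> = ?L' z"
      using \<beta>_range by (simp add: divide_inverse)
    finally have "(?L has_field_derivative ?L' z) (at z)" .
    then show "((\<lambda>z. log_transform r z - ?L z) has_field_derivative ?S z - ?L' z) (at z)"
      by (intro DERIV_diff has_field_derivative_log_transform r_nonneg z_slit) simp_all
  next
    fix y :: real assume y_pos: "0 < y"
    have "?S (of_real y) = expectation (\<lambda>x. of_real (y / (r x + y)) / of_real y)"
      using y_pos by simp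
    also have "\<dots> = of_real (expectation (\<lambda>x. y / (r x + y)) / y)"
      unfolding integral_divide_zero integral_complex_of_real by simp
    also have "\<dots> = of_real (y powr (\<beta> - 1) / (1 + y powr \<beta>))"
      using y_pos by (simp add: stieltjes powr_diff)
    also have "\<dots> = ?L' (of_real y)"
      using y_pos powr_of_real[of y \<beta>] powr_of_real[of y "\<beta> - 1"] by simp
    finally show "?S (of_real y) - ?L' (of_real y) = 0" by simp
  qed (simp_all add: log_transform_def z_slit)
  then show ?thesis by simp
qed

lemma borel_measurable_Arg [measurable]: "Arg \<in> borel_measurable borel"
  unfolding Arg_def[abs_def] by measurable

lemma abs_Arg_le_pi: "\<bar>Arg z\<bar> \<le> pi"
  using mpi_less_Arg[of z] Arg_le_pi[of z] by auto

lemma (in prob_space) expectation_Arg_eq: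
  assumes [measurable]: "random_variable borel r" and r_nonneg: "AE x in M. 0 \<le> r x"
    and z_slit: "z \<notin> \<real>\<^sub>\<le>\<^sub>0"
  shows "expectation (\<lambda>x. Arg (of_real (r x) + z)) = Im (log_transform r z)"
proof -
  have "expectation (\<lambda>x. Arg (of_real (r x) + z))
      = expectation (\<lambda>x. Im (Ln (of_real (r x) + z) - Ln (of_real (r x) + 1)))"
  proof (rule integral_cong_AE)
    show "AE x in M. Arg (of_real (r x) + z) = Im (Ln (of_real (r x) + z) - Ln (of_real (r x) + 1))"
      using r_nonneg
    proof eventually_elim
      case (elim x)
      then have "of_real (r x) + z \<noteq> 0"
        using of_real_add_not_nonpos_Real[OF _ z_slit] by fastforce
      moreover have "Im (Ln (of_real (r x) + 1)) = 0"
        using elim Ln_of_real[of "r x + 1"] by simp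
      ultimately show ?case
        by (simp add: Arg_eq_Im_Ln)
    qed
  qed measurable
  also have "\<dots> = Im (log_transform r z)"
    unfolding log_transform_def by (intro integral_Im integrable_log_transform r_nonneg z_slit) simp
  finally show ?thesis .
qed

text \<open>As \<open>\<phi> \<rightarrow> \<pi>\<close>, the argument of \<open>r + y e\<^bsup>i\<phi>\<^esup>\<close> tends to \<open>0\<close> where \<open>y < r\<close>, and it is at most \<open>\<pi>\<close> elsewhere.\<close>
lemma (in prob_space) stieltjes_inversion_le:
  assumes [measurable]: "random_variable borel r" and r_nonneg: "AE x in M. 0 \<le> r x"
    and y_pos: "0 < y" and \<phi>_seq: "\<And>n. \<bar>\<phi> n\<bar> < pi" "\<phi> \<longlonglongrightarrow> pi"
    and lim: "(\<lambda>n. Im (log_transform r (of_real y * cis (\<phi> n)))) \<longlonglongrightarrow> L"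
  shows "L \<le> pi * prob {x \<in> space M. r x \<le> y}"
proof -
  define g where "g n x = Arg (of_real (r x) + of_real y * cis (\<phi> n))" for n x
  define h where "h n x = (if r x \<le> y then pi else g n x)" for n x
  have [measurable]: "g n \<in> borel_measurable M" "h n \<in> borel_measurable M" for n
    unfolding g_def h_def by measurable
  have g_bound: "\<bar>g n x\<bar> \<le> pi" and h_bound: "\<bar>h n x\<bar> \<le> pi" for n x
    by (simp_all add: g_def h_def abs_Arg_le_pi)
  have "(\<lambda>n. expectation (h n)) \<longlonglongrightarrow> expectation (\<lambda>x. pi * indicator {x \<in> space M. r x \<le> y} x)"
  proof (rule integral_dominated_convergence[where w = "\<lambda>_. pi"])
    show "AE x in M. (\<lambda>n. h n x) \<longlonglongrightarrow> pi * indicator {x \<in> space M. r x \<le> y} x"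
    proof (rule AE_I2)
      fix x assume "x \<in> space M"
      have "(\<lambda>n. g n x) \<longlonglongrightarrow> Arg (of_real (r x) + of_real y * cis pi)" if "y < r x"
        unfolding g_def using that
        by (intro tendsto_intros \<phi>_seq(2)) (auto simp: complex_nonpos_Reals_iff)
      moreover have "Arg (of_real (r x) + of_real y * cis pi) = 0" if "y < r x"
        using that Arg_of_real[of "r x - y"] by simp
      ultimately show "(\<lambda>n. h n x) \<longlonglongrightarrow> pi * indicator {x \<in> space M. r x \<le> y} x"
        using \<open>x \<in> space M\<close> by (cases "r x \<le> y") (auto simp: h_def)
    qed
  qed (use h_bound in auto)
  moreover have "Im (log_transform r (of_real y * cis (\<phi> n))) \<le> expectation (h n)" for n
  proof -
    have "Im (log_transform r (of_real y * cis (\<phi> n))) = expectation (g n)"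
      unfolding g_def
      by (intro expectation_Arg_eq[symmetric] r_nonneg of_real_mult_cis_not_nonpos_Real y_pos \<phi>_seq) simp
    also have "\<dots> \<le> expectation (h n)"
    proof (rule integral_mono)
      show "g n x \<le> h n x" for x using g_bound[of n x] by (auto simp: h_def)
    qed (auto intro!: integrable_const_bound[where B = pi] simp: g_bound h_bound)
    finally show ?thesis .
  qed
  ultimately have "L \<le> expectation (\<lambda>x. pi * indicator {x \<in> space M. r x \<le> y} x)"
    using lim by (intro LIMSEQ_le) auto
  then show ?thesis by simp
qed

lemma (in prob_space) sector_angle_le_prob:
  assumes \<beta>_range: "0 < \<beta>" "\<beta> < 1"
    and [measurable]: "random_variable borel r" and r_nonneg: "AE x in M. 0 \<le> r x"
    and stieltjes: "\<And>y. 0 < y \<Longrightarrow> expectation (\<lambda>x. y / (r x + y)) = y powr \<beta> / (1 + y powr \<beta>)"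
    and y_pos: "0 < y"
  shows "sector_angle (\<beta> * pi) (y powr \<beta>) \<le> \<beta> * pi * prob {x \<in> space M. r x \<le> y}"
proof -
  define \<phi> where "\<phi> n = pi * (1 - inverse (real (Suc n)))" for n
  have range: "0 \<le> \<phi> n" "\<phi> n < pi" for n
    by (auto simp: \<phi>_def field_simps)
  then have abs: "\<bar>\<phi> n\<bar> < pi" for n by simp
  have "\<phi> \<longlonglongrightarrow> pi * (1 - 0)"
    unfolding \<phi>_def by (intro tendsto_intros LIMSEQ_inverse_real_of_nat)
  then have lim: "\<phi> \<longlonglongrightarrow> pi" by simp
  have "Im (log_transform r (of_real y * cis (\<phi> n))) = sector_angle (\<beta> * \<phi> n) (y powr \<beta>) / \<beta>" for n
  proof -
    let ?z = "of_real y * cis (\<phi> n)"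
    have slit: "?z \<notin> \<real>\<^sub>\<le>\<^sub>0"
      by (intro of_real_mult_cis_not_nonpos_Real y_pos abs)
    have "Arg ?z = \<phi> n" "norm ?z = y"
      using y_pos range[of n] Arg_rcis[of "\<phi> n" y] by (simp_all add: rcis_def norm_mult)
    then have "?z powr of_real \<beta> = of_real (y powr \<beta>) * cis (\<beta> * \<phi> n)"
      using y_pos by (subst powr_of_real_eq_polar) auto
    moreover have "1 + ?z powr of_real \<beta> \<noteq> 0"
      using one_plus_powr_not_nonpos_Real[OF slit \<beta>_range] by auto
    ultimately show ?thesis
      using log_transform_eq[OF \<beta>_range _ r_nonneg stieltjes slit] Ln_of_real[of 2]
      by (simp add: sector_angle_def Arg_eq_Im_Ln Im_divide_of_real)
  qed
  moreover have "(\<lambda>n. sector_angle (\<beta> * \<phi> n) (y powr \<beta>) / \<beta>) \<longlonglongrightarrow> sector_angle (\<beta> * pi) (y powr \<beta>) / \<beta>"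
    unfolding sector_angle_def using \<beta>_range one_plus_cis_not_nonpos_Real[of "\<beta> * pi" "y powr \<beta>"]
    by (intro tendsto_intros lim) (auto simp: abs_mult)
  ultimately have "sector_angle (\<beta> * pi) (y powr \<beta>) / \<beta> \<le> pi * prob {x \<in> space M. r x \<le> y}"
    by (intro stieltjes_inversion_le[OF _ r_nonneg y_pos abs lim]) simp_all
  then show ?thesis
    using \<beta>_range by (simp add: field_simps)
qed

subsection \<open>Laplace transforms\<close>

definition laplace_transform :: "real measure \<Rightarrow> real \<Rightarrow> real" where
  "laplace_transform M l = (\<integral>x. exp (- (l * x)) \<partial>M)"

locale nonneg_distribution = real_distribution +
  assumes AE_nonneg: "AE x in M. 0 \<le> x"
begin

lemma integrable_exp_minus:
  assumes "0 \<le> l"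
  shows "integrable M (\<lambda>x. exp (- (l * x)))"
proof (rule integrable_const_bound[where B = 1])
  show "AE x in M. norm (exp (- (l * x))) \<le> 1"
    using AE_nonneg by eventually_elim (use assms in simp)
qed simp

lemma cdf_tail_le_laplace_transform:
  assumes "0 < l"
  shows "(1 - exp (- 1)) * (1 - cdf M (1 / l)) \<le> 1 - laplace_transform M l"
proof -
  have "(1 - exp (- 1)) * (1 - cdf M (1 / l)) = (1 - exp (- 1)) * prob {1 / l<..}"
  proof -
    have "{1 / l<..} = space M - {..1 / l}" by auto
    then show ?thesis
      using prob_compl[of "{..1 / l}"] by (simp add: cdf_def)
  qed
  also have "\<dots> = (\<integral>x. (1 - exp (- 1)) * indicator {1 / l<..} x \<partial>M)"
    by simp
  also have "\<dots> \<le> (\<integral>x. 1 - exp (- (l * x)) \<partial>M)"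
  proof (rule integral_mono_AE)
    show "AE x in M. (1 - exp (- 1)) * indicator {1 / l<..} x \<le> 1 - exp (- (l * x))"
      using AE_nonneg
      by eventually_elim (use assms in \<open>auto simp: indicator_def field_simps\<close>)
  qed (use integrable_exp_minus assms in \<open>auto intro!: integrable_real_indicator simp: emeasure_eq_measure\<close>)
  also have "\<dots> = 1 - laplace_transform M l"
    using integrable_exp_minus assms prob_space by (simp add: laplace_transform_def)
  finally show ?thesis .
qed

lemma measure_greaterThanAtMost_eq_cdf:
  assumes "a < 0"
  shows "measure M {a<..b} = cdf M b"
  unfolding cdf_def
  by (intro finite_measure_eq_AE) (use AE_nonneg assms in \<open>auto elim!: eventually_mono\<close>)

lemma prob_zero_le_laplace_transform:
  assumes "0 \<le> l"
  shows "prob {0} \<le> laplace_transform M l"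
proof -
  have "prob {0} = (\<integral>x. indicator {0} x \<partial>M)" by simp
  also have "\<dots> \<le> laplace_transform M l"
    unfolding laplace_transform_def
    by (intro integral_mono') (auto simp: indicator_def intro: integrable_exp_minus assms)
  finally show ?thesis .
qed

lemma AE_pos_if_laplace_transform_vanishes:
  assumes "(laplace_transform M \<longlongrightarrow> 0) at_top"
  shows "AE x in M. 0 < x"
proof -
  have "prob {0} \<le> 0"
    by (rule tendsto_lowerbound[OF assms])
       (auto intro!: eventually_mono[OF eventually_ge_at_top[of 0]] prob_zero_le_laplace_transform)
  then have "AE x in M. x \<noteq> 0"
    by (intro AE_I[of _ _ "{0}"]) (auto simp: emeasure_eq_measure measure_le_0_iff)
  with AE_nonneg show ?thesis
    by eventually_elim auto
qed

lemma
  assumes "0 < u"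
  shows integrable_mult_exp_minus: "integrable M (\<lambda>x. x * exp (- (u * x)))"
    and laplace_transform_has_real_derivative:
      "(laplace_transform M has_real_derivative - (\<integral>x. x * exp (- (u * x)) \<partial>M)) (at u)"
proof -
  have bound: "\<bar>x * exp (- (l * x))\<bar> \<le> 2 / u" if "u / 2 < l" "0 \<le> x" for l x
  proof -
    have "0 < l" using that(1) assms by linarith
    have "l * x \<le> exp (l * x)"
      using exp_ge_add_one_self[of "l * x"] by linarith
    then have "x * exp (- (l * x)) \<le> 1 / l"
      using \<open>0 < l\<close> by (simp add: exp_minus field_simps)
    also have "\<dots> \<le> 2 / u"
      using that(1) assms \<open>0 < l\<close> by (simp add: field_simps)
    finally show ?thesis using that(2) by simp
  qed
  have AE_bound: "AE x in M. \<forall>l\<in>{u / 2<..}. norm (- (x * exp (- (l * x)))) \<le> 2 / u"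
    using AE_nonneg by eventually_elim (use bound in auto)
  then have "AE x in M. norm (x * exp (- (u * x))) \<le> 2 / u"
    by eventually_elim (use assms in auto)
  then show "integrable M (\<lambda>x. x * exp (- (u * x)))"
    by (intro integrable_const_bound) auto
  have "((\<lambda>l. \<integral>x. exp (- (l * x)) \<partial>M) has_real_derivative (\<integral>x. - (x * exp (- (u * x))) \<partial>M)) (at u)"
  proof (rule has_field_derivative_integral[OF _ _ _ _ _ _ _ AE_bound])
    show "integrable M (\<lambda>x. exp (- (l * x)))" if "l \<in> {u / 2<..}" for l
      using that assms by (intro integrable_exp_minus) auto
    show "AE x in M. \<forall>l\<in>{u / 2<..}. ((\<lambda>l. exp (- (l * x))) has_real_derivative - (x * exp (- (l * x)))) (at l)"
      by (auto intro!: derivative_eq_intros)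
  qed (use assms in auto)
  then show "(laplace_transform M has_real_derivative - (\<integral>x. x * exp (- (u * x)) \<partial>M)) (at u)"
    by (simp add: laplace_transform_def[abs_def])
qed

end

lemma nonneg_distribution_weak_limit:
  assumes nonneg_\<mu>: "\<And>n. nonneg_distribution (\<mu> n)" and real_\<nu>: "real_distribution \<nu>"
    and conv: "weak_conv_m \<mu> \<nu>"
  shows "nonneg_distribution \<nu>"
proof -
  interpret \<mu>: nonneg_distribution "\<mu> n" for n by (rule nonneg_\<mu>)
  interpret \<nu>: real_distribution \<nu> by (rule real_\<nu>)
  let ?g = "\<lambda>x::real. min 1 (max 0 (- x))"
  have "(\<integral>x. ?g x \<partial>\<mu> n) = 0" for n
  proof -
    have "AE x in \<mu> n. ?g x = 0"
      using \<mu>.AE_nonneg[of n] by eventually_elim auto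
    then show ?thesis by (rule integral_eq_zero_AE)
  qed
  moreover have "(\<lambda>n. \<integral>x. ?g x \<partial>\<mu> n) \<longlonglongrightarrow> (\<integral>x. ?g x \<partial>\<nu>)"
    by (rule weak_conv_imp_integral_bdd_continuous_conv[OF \<mu>.real_distribution_axioms real_\<nu> conv, where B = 1])
       (auto intro!: continuous_intros)
  ultimately have "(\<integral>x. ?g x \<partial>\<nu>) = 0"
    by (simp add: LIMSEQ_const_iff)
  moreover have "integrable \<nu> ?g"
    by (intro \<nu>.integrable_const_bound[where B = 1]) auto
  ultimately have "AE x in \<nu>. ?g x = 0"
    by (subst (asm) integral_nonneg_eq_0_iff_AE) auto
  then have "AE x in \<nu>. 0 \<le> x"
    by eventually_elim (auto simp: min_def max_def split: if_splits)
  then show ?thesis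
    by (simp add: nonneg_distribution_def nonneg_distribution_axioms_def real_\<nu>)
qed

lemma laplace_transform_weak_conv:
  assumes nonneg_\<mu>: "\<And>n. nonneg_distribution (\<mu> n)" and nonneg_\<nu>: "nonneg_distribution \<nu>"
    and conv: "weak_conv_m \<mu> \<nu>" and l_nonneg: "0 \<le> l"
  shows "(\<lambda>n. laplace_transform (\<mu> n) l) \<longlonglongrightarrow> laplace_transform \<nu> l"
proof -
  interpret \<mu>: nonneg_distribution "\<mu> n" for n by (rule nonneg_\<mu>)
  interpret \<nu>: nonneg_distribution \<nu> by (rule nonneg_\<nu>)
  have laplace_abs: "laplace_transform M l = (\<integral>x. exp (- (l * \<bar>x\<bar>)) \<partial>M)" if "nonneg_distribution M" for M
  proof -
    interpret nonneg_distribution M by (rule that)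
    have "AE x in M. exp (- (l * x)) = exp (- (l * \<bar>x\<bar>))"
      using AE_nonneg by eventually_elim simp
    then show ?thesis
      unfolding laplace_transform_def by (intro integral_cong_AE) auto
  qed
  show ?thesis
    unfolding laplace_abs[OF nonneg_\<mu>] laplace_abs[OF nonneg_\<nu>]
    by (rule weak_conv_imp_integral_bdd_continuous_conv
          [OF \<mu>.real_distribution_axioms \<nu>.real_distribution_axioms conv, where B = 1])
       (use l_nonneg in auto)
qed

lemma eventually_cdf_gt_if_laplace_transform_tendsto:
  assumes nonneg_\<mu>: "\<And>n. nonneg_distribution (\<mu> n)"
    and lim: "\<And>l. 0 < l \<Longrightarrow> (\<lambda>n. laplace_transform (\<mu> n) l) \<longlonglongrightarrow> L l"
    and L_tendsto: "(L \<longlongrightarrow> 1) (at_right 0)" and e_pos: "0 < e"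
  obtains b where "eventually (\<lambda>n. 1 - e < cdf (\<mu> n) b) sequentially"
proof -
  define d where "d = 1 - exp (- 1 :: real)"
  have d_pos: "0 < d" by (simp add: d_def)
  have "eventually (\<lambda>l. 0 < l \<and> 1 - d * e < L l) (at_right 0)"
    using order_tendstoD(1)[OF L_tendsto, of "1 - d * e"] d_pos e_pos
    by (auto simp: eventually_conj_iff eventually_at_right_less)
  then obtain l where l_props: "0 < l" "1 - d * e < L l"
    by (auto dest: eventually_happens)
  have "eventually (\<lambda>n. 1 - d * e < laplace_transform (\<mu> n) l) sequentially"
    by (rule order_tendstoD(1)[OF lim[OF l_props(1)] l_props(2)])
  then have "eventually (\<lambda>n. 1 - e < cdf (\<mu> n) (1 / l)) sequentially"
  proof eventually_elim
    case (elim n)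
    then have "d * (1 - cdf (\<mu> n) (1 / l)) < d * e"
      using nonneg_distribution.cdf_tail_le_laplace_transform[OF nonneg_\<mu> l_props(1), of n]
      unfolding d_def by linarith
    then show ?case using d_pos by simp
  qed
  then show thesis by (rule that)
qed

lemma tight_if_laplace_transform_tendsto:
  assumes nonneg_\<mu>: "\<And>n. nonneg_distribution (\<mu> n)"
    and lim: "\<And>l. 0 < l \<Longrightarrow> (\<lambda>n. laplace_transform (\<mu> n) l) \<longlonglongrightarrow> L l"
    and L_tendsto: "(L \<longlongrightarrow> 1) (at_right 0)"
  shows "tight \<mu>"
proof -
  interpret \<mu>: nonneg_distribution "\<mu> n" for n by (rule nonneg_\<mu>)
  show ?thesis
    unfolding tight_def
  proof (intro conjI allI impI \<mu>.real_distribution_axioms)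
    fix e :: real assume e_pos: "0 < e"
    from eventually_cdf_gt_if_laplace_transform_tendsto[OF nonneg_\<mu> lim L_tendsto e_pos]
    obtain b0 where "eventually (\<lambda>n. 1 - e < cdf (\<mu> n) b0) sequentially" .
    then obtain n0 where n0_tail: "\<And>n. n0 \<le> n \<Longrightarrow> 1 - e < cdf (\<mu> n) b0"
      by (auto simp: eventually_sequentially)
    have "eventually (\<lambda>b. \<forall>n\<in>{..<n0}. 1 - e < cdf (\<mu> n) b) at_top"
      using e_pos by (intro eventually_ball_finite ballI order_tendstoD(1)[OF \<mu>.cdf_lim_at_top_prob]) auto
    with eventually_ge_at_top[of "max 0 b0"]
    have "eventually (\<lambda>b. max 0 b0 \<le> b \<and> (\<forall>n\<in>{..<n0}. 1 - e < cdf (\<mu> n) b)) at_top"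
      by (rule eventually_conj)
    then obtain b where b_bounds: "0 \<le> b" "b0 \<le> b" "\<And>n. n < n0 \<Longrightarrow> 1 - e < cdf (\<mu> n) b"
      by (auto dest: eventually_happens)
    have "1 - e < measure (\<mu> n) {- 1<..b}" for n
      using b_bounds(3)[of n] n0_tail[of n] \<mu>.cdf_nondecreasing[OF b_bounds(2), of n]
      by (cases "n < n0") (auto simp: \<mu>.measure_greaterThanAtMost_eq_cdf)
    with b_bounds(1) show "\<exists>a b. a < b \<and> (\<forall>n. 1 - e < measure (\<mu> n) {a<..b})"
      by (intro exI[of _ "- 1"] exI[of _ b]) auto
  qed
qed

theorem laplace_continuity:
  assumes nonneg_\<mu>: "\<And>n. nonneg_distribution (\<mu> n)"
    and lim: "\<And>l. 0 < l \<Longrightarrow> (\<lambda>n. laplace_transform (\<mu> n) l) \<longlonglongrightarrow> L l"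
    and L_tendsto: "(L \<longlongrightarrow> 1) (at_right 0)"
  obtains \<nu> where "nonneg_distribution \<nu>" "\<And>l. 0 < l \<Longrightarrow> laplace_transform \<nu> l = L l"
proof -
  have "tight \<mu>" by (rule tight_if_laplace_transform_tendsto[OF nonneg_\<mu> lim L_tendsto])
  from tight_imp_convergent_subsubsequence[OF this strict_mono_id]
  obtain r \<nu> where r_mono: "strict_mono r" and real_\<nu>: "real_distribution \<nu>"
    and conv: "weak_conv_m (\<lambda>n. \<mu> (r n)) \<nu>"
    by (auto simp: comp_def)
  have nonneg: "nonneg_distribution \<nu>"
    by (rule nonneg_distribution_weak_limit[OF nonneg_\<mu> real_\<nu> conv])
  moreover have "laplace_transform \<nu> l = L l" if "0 < l" for l
  proof (rule LIMSEQ_unique)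
    show "(\<lambda>n. laplace_transform (\<mu> (r n)) l) \<longlonglongrightarrow> laplace_transform \<nu> l"
      using that by (intro laplace_transform_weak_conv nonneg_\<mu> nonneg conv) auto
    show "(\<lambda>n. laplace_transform (\<mu> (r n)) l) \<longlonglongrightarrow> L l"
      using LIMSEQ_subseq_LIMSEQ[OF lim[OF that] r_mono] by (simp add: comp_def)
  qed
  ultimately show thesis by (rule that)
qed

subsection \<open>Existence of positive stable laws\<close>

locale positive_stable_distribution = nonneg_distribution +
  fixes \<beta> :: real
  assumes exponent_pos: "0 < \<beta>"
    and laplace_transform_eq: "0 < l \<Longrightarrow> laplace_transform M l = exp (- (l powr \<beta>))"

text \<open>If \<open>U\<close> is uniform, then \<open>n (1 - E exp (- \<mu> (n U)\<^bsup>-1/\<beta>\<^esup>))\<close> is the integral of this kernel over \<open>{0..n}\<close>,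
  which tends to a multiple of \<open>\<mu>\<^bsup>\<beta>\<^esup>\<close>. Hence sums of \<open>n\<close> such Pareto variables approach a positive stable law.\<close>

definition pareto_kernel :: "real \<Rightarrow> real \<Rightarrow> real \<Rightarrow> real" where
  "pareto_kernel \<beta> \<mu> v = (1 - exp (- (\<mu> * v powr (- 1 / \<beta>)))) * indicator {0<..} v"

lemma borel_measurable_pareto_kernel [measurable]: "pareto_kernel \<beta> \<mu> \<in> borel_measurable borel"
  unfolding pareto_kernel_def by measurable

lemma pareto_kernel_bounds:
  assumes "0 \<le> \<mu>"
  shows "0 \<le> pareto_kernel \<beta> \<mu> v" "pareto_kernel \<beta> \<mu> v \<le> 1"
  using assms by (auto simp: pareto_kernel_def indicator_def)

lemma integrable_powr_tail:
  assumes "1 < p"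
  shows "integrable lborel (\<lambda>v. v powr (- p) * indicator {1..} v :: real)"
proof (rule integrableI_nonneg)
  let ?F = "\<lambda>v :: real. - (v powr (1 - p)) / (p - 1)"
  have "(\<integral>\<^sup>+v. ennreal (v powr (- p)) * indicator {1..} v \<partial>lborel) = ennreal (0 - ?F 1)"
  proof (rule nn_integral_FTC_atLeast[where F = ?F])
    fix v :: real assume "1 \<le> v"
    then have "(?F has_real_derivative - ((1 - p) * v powr (1 - p - 1)) / (p - 1)) (at v)"
      using assms by (intro derivative_eq_intros refl) auto
    also have "- ((1 - p) * v powr (1 - p - 1)) / (p - 1) = v powr (- p)"
      using assms by (simp add: field_simps)
    finally show "(?F has_real_derivative v powr (- p)) (at v)" .
  next
    have "((\<lambda>v. v powr (1 - p)) \<longlongrightarrow> 0) at_top"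
      using assms by (intro tendsto_neg_powr filterlim_ident) auto
    then have "(?F \<longlongrightarrow> - 0 / (p - 1)) at_top"
      using assms by (intro tendsto_intros) auto
    then show "(?F \<longlongrightarrow> 0) at_top" by simp
  qed auto
  then show "(\<integral>\<^sup>+v. ennreal (v powr (- p) * indicator {1..} v) \<partial>lborel) < \<infinity>"
    by (simp add: ennreal_mult' ennreal_indicator)
qed auto

lemma integrable_pareto_kernel:
  assumes \<beta>_range: "0 < \<beta>" "\<beta> < 1" and \<mu>_nonneg: "0 \<le> \<mu>"
  shows "integrable lborel (pareto_kernel \<beta> \<mu>)"
proof (rule Bochner_Integration.integrable_bound)
  let ?B = "\<lambda>v. indicator {0..1} v + \<mu> * (v powr (- (1 / \<beta>)) * indicator {1..} v) :: real"
  show "integrable lborel ?B"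
    using \<beta>_range by (intro Bochner_Integration.integrable_add integrable_mult_right integrable_powr_tail) auto
  have "norm (pareto_kernel \<beta> \<mu> v) \<le> norm (?B v)" for v
  proof (cases "v \<le> 1")
    case True
    then show ?thesis
      using pareto_kernel_bounds[OF \<mu>_nonneg, of \<beta> v] \<mu>_nonneg
      by (cases "0 < v"; cases "v = 1") (auto simp: pareto_kernel_def[of _ _ v] indicator_def add_nonneg_nonneg)
  next
    case False
    then have "pareto_kernel \<beta> \<mu> v \<le> \<mu> * v powr (- (1 / \<beta>))"
      using exp_ge_add_one_self[of "- (\<mu> * v powr (- 1 / \<beta>))"] by (simp add: pareto_kernel_def)
    then show ?thesis
      using False pareto_kernel_bounds[OF \<mu>_nonneg, of \<beta> v] \<mu>_nonneg by simp
  qed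
  then show "AE v in lborel. norm (pareto_kernel \<beta> \<mu> v) \<le> norm (?B v)"
    by simp
qed auto

lemma integral_pareto_kernel_scale:
  assumes \<beta>_pos: "0 < \<beta>" and \<mu>_nonneg: "0 \<le> \<mu>"
  shows "(\<integral>v. pareto_kernel \<beta> \<mu> v \<partial>lborel) = \<mu> powr \<beta> * (\<integral>v. pareto_kernel \<beta> 1 v \<partial>lborel)"
proof (cases "\<mu> = 0")
  case False
  with \<mu>_nonneg have pos: "0 < \<mu>" by simp
  have "pareto_kernel \<beta> \<mu> (0 + \<mu> powr \<beta> * v) = pareto_kernel \<beta> 1 v" for v
  proof (cases "0 < v")
    case True
    have "(\<mu> powr \<beta> * v) powr (- 1 / \<beta>) = \<mu> powr (- 1) * v powr (- 1 / \<beta>)"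
      using True pos \<beta>_pos by (simp add: powr_mult powr_powr)
    then show ?thesis
      using True pos by (simp add: pareto_kernel_def powr_minus_divide indicator_def zero_less_mult_iff)
  qed (use pos in \<open>auto simp: pareto_kernel_def indicator_def zero_less_mult_iff\<close>)
  then show ?thesis
    using pos lborel_integral_real_affine[of "\<mu> powr \<beta>" "pareto_kernel \<beta> \<mu>" 0] by simp
qed (simp add: pareto_kernel_def)

lemma integral_pareto_kernel_pos:
  assumes \<beta>_range: "0 < \<beta>" "\<beta> < 1"
  shows "0 < (\<integral>v. pareto_kernel \<beta> 1 v \<partial>lborel)"
proof -
  have "0 < 1 - exp (- 1 :: real)" by simp
  also have "\<dots> = (\<integral>v. (1 - exp (- 1)) * indicator {0<..1::real} v \<partial>lborel)"
    by simp
  also have "\<dots> \<le> (\<integral>v. pareto_kernel \<beta> 1 v \<partial>lborel)"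
  proof (rule Bochner_Integration.integral_mono)
    show "integrable lborel (pareto_kernel \<beta> 1)" using \<beta>_range by (intro integrable_pareto_kernel) auto
    show "(1 - exp (- 1)) * indicator {0<..1} v \<le> pareto_kernel \<beta> 1 v" for v :: real
    proof (cases "v \<in> {0<..1}")
      case True
      then have "1 powr (- 1 / \<beta>) \<le> v powr (- 1 / \<beta>)"
        using \<beta>_range by (intro powr_mono2') auto
      then show ?thesis using True by (simp add: pareto_kernel_def)
    qed (use pareto_kernel_bounds[of 1 \<beta> v] in auto)
  qed auto
  finally show ?thesis .
qed

definition truncated_pareto_integral :: "real \<Rightarrow> real \<Rightarrow> nat \<Rightarrow> real" where
  "truncated_pareto_integral \<beta> \<mu> n = (\<integral>v. pareto_kernel \<beta> \<mu> v * indicator {..real n} v \<partial>lborel)"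

lemma truncated_pareto_integral_tendsto:
  assumes "0 < \<beta>" "\<beta> < 1" "0 \<le> \<mu>"
  shows "truncated_pareto_integral \<beta> \<mu> \<longlonglongrightarrow> (\<integral>v. pareto_kernel \<beta> \<mu> v \<partial>lborel)"
  unfolding truncated_pareto_integral_def[abs_def]
proof (rule integral_dominated_convergence[where w = "pareto_kernel \<beta> \<mu>"])
  show "integrable lborel (pareto_kernel \<beta> \<mu>)"
    by (rule integrable_pareto_kernel[OF assms])
  have "(\<lambda>n. pareto_kernel \<beta> \<mu> v * indicator {..real n} v) \<longlonglongrightarrow> pareto_kernel \<beta> \<mu> v" for v
  proof (rule tendsto_eventually, rule eventually_sequentiallyI[of "nat \<lceil>v\<rceil>"])
    fix n assume "nat \<lceil>v\<rceil> \<le> n"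
    then have "v \<le> real n" by linarith
    then show "pareto_kernel \<beta> \<mu> v * indicator {..real n} v = pareto_kernel \<beta> \<mu> v" by simp
  qed
  then show "AE v in lborel. (\<lambda>n. pareto_kernel \<beta> \<mu> v * indicator {..real n} v) \<longlonglongrightarrow> pareto_kernel \<beta> \<mu> v"
    by simp
  show "AE v in lborel. norm (pareto_kernel \<beta> \<mu> v * indicator {..real n} v) \<le> pareto_kernel \<beta> \<mu> v" for n
    using pareto_kernel_bounds[OF assms(3), of \<beta>] by (auto simp: indicator_def)
qed auto

abbreviation unit_uniform :: "real measure" where
  "unit_uniform \<equiv> uniform_measure lborel {0<..1}"

lemma prob_space_unit_uniform: "prob_space unit_uniform"
  by (rule prob_space_uniform_measure) auto

lemma integral_unit_uniform:
  fixes f :: "real \<Rightarrow> real"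
  assumes "f \<in> borel_measurable borel"
  shows "(\<integral>u. f u \<partial>unit_uniform) = (\<integral>u. indicator {0<..1} u * f u \<partial>lborel)"
proof -
  have "unit_uniform = density lborel (\<lambda>u. ennreal (indicator {0<..1} u))"
    unfolding uniform_measure_def by (intro density_cong) (auto simp: indicator_def)
  then show ?thesis
    using assms by (simp add: integral_density)
qed

lemma integral_exp_minus_pareto:
  assumes \<beta>_range: "0 < \<beta>" "\<beta> < 1" and \<mu>_nonneg: "0 \<le> \<mu>" and n_pos: "0 < n"
  shows "(\<integral>u. exp (- (\<mu> * (real n * u) powr (- 1 / \<beta>))) \<partial>unit_uniform)
    = 1 - truncated_pareto_integral \<beta> \<mu> n / real n"
proof -
  let ?f = "\<lambda>v. pareto_kernel \<beta> \<mu> v * indicator {..real n} v"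
  have integrable_f: "integrable lborel ?f"
    using integrable_mult_indicator[of "{..real n}", OF _ integrable_pareto_kernel[OF \<beta>_range \<mu>_nonneg]]
    by (simp add: mult.commute)
  have "(\<integral>u. exp (- (\<mu> * (real n * u) powr (- 1 / \<beta>))) \<partial>unit_uniform)
      = (\<integral>u. indicator {0<..1} u - ?f (0 + real n * u) \<partial>lborel)"
    using n_pos by (subst integral_unit_uniform)
      (auto intro!: Bochner_Integration.integral_cong simp: pareto_kernel_def indicator_def zero_less_mult_iff)
  also have "\<dots> = (\<integral>u. indicator {0<..1::real} u \<partial>lborel) - (\<integral>u. ?f (0 + real n * u) \<partial>lborel)"
    using n_pos by (intro Bochner_Integration.integral_diff lborel_integrable_real_affine[OF integrable_f]) auto
  also have "(\<integral>u. ?f (0 + real n * u) \<partial>lborel) = truncated_pareto_integral \<beta> \<mu> n / real n"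
    using n_pos lborel_integral_real_affine[of "real n" ?f 0] by (simp add: truncated_pareto_integral_def)
  finally show ?thesis by simp
qed

definition pareto_sum :: "real \<Rightarrow> real \<Rightarrow> nat \<Rightarrow> (nat \<Rightarrow> real) \<Rightarrow> real" where
  "pareto_sum \<beta> \<kappa> n \<omega> = (\<Sum>i<n. \<kappa> * (real n * \<omega> i) powr (- 1 / \<beta>))"

definition pareto_sum_distribution :: "real \<Rightarrow> real \<Rightarrow> nat \<Rightarrow> real measure" where
  "pareto_sum_distribution \<beta> \<kappa> n = distr (PiM {..<n} (\<lambda>_. unit_uniform)) borel (pareto_sum \<beta> \<kappa> n)"

lemma borel_measurable_pareto_sum [measurable]:
  "pareto_sum \<beta> \<kappa> n \<in> borel_measurable (PiM {..<n} (\<lambda>_. unit_uniform))"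
  unfolding pareto_sum_def by measurable

lemma nonneg_pareto_sum_distribution:
  assumes "0 \<le> \<kappa>"
  shows "nonneg_distribution (pareto_sum_distribution \<beta> \<kappa> n)"
proof -
  have "prob_space (PiM {..<n} (\<lambda>_. unit_uniform))"
    by (intro prob_space_PiM prob_space_unit_uniform)
  then have "real_distribution (pareto_sum_distribution \<beta> \<kappa> n)"
    unfolding pareto_sum_distribution_def by (intro prob_space.real_distribution_distr) simp_all
  moreover have "0 \<le> pareto_sum \<beta> \<kappa> n \<omega>" for \<omega>
    unfolding pareto_sum_def using assms by (intro sum_nonneg) auto
  then have "AE x in pareto_sum_distribution \<beta> \<kappa> n. 0 \<le> x"
    unfolding pareto_sum_distribution_def by (subst AE_distr_iff) auto
  ultimately show ?thesis
    by (simp add: nonneg_distribution_def nonneg_distribution_axioms_def)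
qed

lemma laplace_transform_pareto_sum:
  assumes \<beta>_range: "0 < \<beta>" "\<beta> < 1" and "0 \<le> \<kappa>" "0 \<le> l" "0 < n"
  shows "laplace_transform (pareto_sum_distribution \<beta> \<kappa> n) l
    = (1 - truncated_pareto_integral \<beta> (l * \<kappa>) n / real n) ^ n"
proof -
  interpret U: prob_space unit_uniform by (rule prob_space_unit_uniform)
  interpret P: product_sigma_finite "\<lambda>_::nat. unit_uniform"
    by unfold_locales
  let ?P = "PiM {..<n} (\<lambda>_. unit_uniform)"
  let ?f = "\<lambda>u. exp (- (l * \<kappa> * (real n * u) powr (- 1 / \<beta>)))"
  have "laplace_transform (pareto_sum_distribution \<beta> \<kappa> n) l = (\<integral>\<omega>. exp (- (l * pareto_sum \<beta> \<kappa> n \<omega>)) \<partial>?P)"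
    unfolding laplace_transform_def pareto_sum_distribution_def by (intro integral_distr) auto
  also have "\<dots> = (\<integral>\<omega>. (\<Prod>i<n. ?f (\<omega> i)) \<partial>?P)"
    by (simp add: pareto_sum_def sum_distrib_left exp_sum mult.assoc flip: sum_negf)
  also have "\<dots> = (\<Prod>i<n. \<integral>u. ?f u \<partial>unit_uniform)"
    using assms by (intro P.product_integral_prod U.integrable_const_bound[where B = 1]) auto
  also have "\<dots> = (1 - truncated_pareto_integral \<beta> (l * \<kappa>) n / real n) ^ n"
    using integral_exp_minus_pareto[OF \<beta>_range, of "l * \<kappa>" n] assms by simp
  finally show ?thesis .
qed

lemma tendsto_one_plus_over_n_power:
  fixes a :: "nat \<Rightarrow> real"
  assumes "a \<longlonglongrightarrow> A"
  shows "(\<lambda>n. (1 + a n / real n) ^ n) \<longlonglongrightarrow> exp A"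
proof -
  have small: "(\<lambda>n. a n / real n) \<longlonglongrightarrow> 0"
    using tendsto_mult[OF assms lim_1_over_n] by simp
  have "(\<lambda>n. real n * ln (1 + a n / real n) - a n) \<longlonglongrightarrow> 0"
  proof (rule Lim_null_comparison)
    have "(\<lambda>n. 2 * a n * (a n / real n)) \<longlonglongrightarrow> 2 * A * 0"
      by (intro tendsto_intros assms small)
    then show "(\<lambda>n. 2 * a n * (a n / real n)) \<longlonglongrightarrow> 0" by simp
    have "eventually (\<lambda>n. \<bar>a n / real n\<bar> < 1 / 2 \<and> 0 < n) sequentially"
      using order_tendstoD(2)[OF tendsto_rabs[OF small], of "1 / 2"] eventually_gt_at_top[of 0]
      by (auto simp: eventually_conj_iff)
    then show "eventually (\<lambda>n. norm (real n * ln (1 + a n / real n) - a n)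
        \<le> 2 * a n * (a n / real n)) sequentially"
    proof eventually_elim
      case (elim n)
      let ?u = "a n / real n"
      have "real n * ln (1 + ?u) - a n = real n * (ln (1 + ?u) - ?u)"
        using elim by (simp add: right_diff_distrib)
      then have "norm (real n * ln (1 + ?u) - a n) = real n * \<bar>ln (1 + ?u) - ?u\<bar>"
        by (simp add: abs_mult)
      also have "\<dots> \<le> real n * (2 * ?u\<^sup>2)"
        using elim by (intro mult_left_mono abs_ln_one_plus_x_minus_x_bound) auto
      finally show ?case
        using elim by (simp add: power2_eq_square)
    qed
  qed
  then have "(\<lambda>n. exp (real n * ln (1 + a n / real n) - a n + a n)) \<longlonglongrightarrow> exp (0 + A)"
    by (intro tendsto_intros assms)
  moreover have "eventually (\<lambda>n. \<bar>a n / real n\<bar> < 1) sequentially"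
    using order_tendstoD(2)[OF tendsto_rabs[OF small], of 1] by simp
  then have "eventually (\<lambda>n. exp (real n * ln (1 + a n / real n) - a n + a n)
      = (1 + a n / real n) ^ n) sequentially"
  proof eventually_elim
    case (elim n)
    then have "0 < 1 + a n / real n" by linarith
    then show ?case by (simp add: exp_of_nat_mult)
  qed
  ultimately show ?thesis
    using tendsto_cong by force
qed

theorem positive_stable_distribution_exists:
  assumes \<beta>_range: "0 < \<beta>" "\<beta> < 1"
  shows "\<exists>\<nu>. positive_stable_distribution \<nu> \<beta>"
proof -
  define I where "I = (\<integral>v. pareto_kernel \<beta> 1 v \<partial>lborel)"
  define \<kappa> where "\<kappa> = (1 / I) powr (1 / \<beta>)"
  have "0 < I" unfolding I_def by (rule integral_pareto_kernel_pos[OF \<beta>_range])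
  then have \<kappa>_props: "0 < \<kappa>" "\<kappa> powr \<beta> * I = 1"
    using \<beta>_range by (auto simp: \<kappa>_def powr_powr)
  show ?thesis
  proof (rule laplace_continuity)
    show "nonneg_distribution (pareto_sum_distribution \<beta> \<kappa> (Suc n))" for n
      using \<kappa>_props by (intro nonneg_pareto_sum_distribution) simp
    show "(\<lambda>n. laplace_transform (pareto_sum_distribution \<beta> \<kappa> (Suc n)) l) \<longlonglongrightarrow> exp (- (l powr \<beta>))"
      if l_pos: "0 < l" for l
    proof -
      have "(\<integral>v. pareto_kernel \<beta> (l * \<kappa>) v \<partial>lborel) = l powr \<beta>"
        using integral_pareto_kernel_scale[OF \<beta>_range(1), of "l * \<kappa>"] l_pos \<kappa>_props
        by (simp add: powr_mult mult.assoc flip: I_def)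
      then have "(\<lambda>n. - truncated_pareto_integral \<beta> (l * \<kappa>) n) \<longlonglongrightarrow> - (l powr \<beta>)"
        using truncated_pareto_integral_tendsto[OF \<beta>_range, of "l * \<kappa>"] l_pos \<kappa>_props
        by (intro tendsto_minus) simp
      from LIMSEQ_Suc[OF tendsto_one_plus_over_n_power[OF this]] show ?thesis
        using l_pos \<kappa>_props
        by (simp add: laplace_transform_pareto_sum[OF \<beta>_range] del: of_nat_Suc power_Suc)
    qed
    show "((\<lambda>l. exp (- (l powr \<beta>))) \<longlongrightarrow> 1) (at_right 0)"
      using \<beta>_range by real_asymp
    show ?thesis if "nonneg_distribution \<nu>" "\<And>l. 0 < l \<Longrightarrow> laplace_transform \<nu> l = exp (- (l powr \<beta>))" for \<nu>
      using that \<beta>_range(1)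
      by (auto simp: positive_stable_distribution_def positive_stable_distribution_axioms_def)
  qed
qed

subsection \<open>The ratio of two positive stable variables\<close>

lemma nn_integral_weibull:
  fixes \<beta> c :: real
  assumes \<beta>_pos: "0 < \<beta>" and c_pos: "0 < c"
  shows "(\<integral>\<^sup>+u. ennreal (\<beta> * u powr (\<beta> - 1) * exp (- (c * u powr \<beta>))) * indicator {0<..} u \<partial>lborel)
    = ennreal (1 / c)"
proof -
  let ?f = "\<lambda>u::real. \<beta> * u powr (\<beta> - 1) * exp (- (c * u powr \<beta>))"
  let ?F = "\<lambda>u::real. - (exp (- (c * u powr \<beta>)) / c)"
  have interval: "einterval (ereal 0) \<infinity> = {0<..}"
    by (auto simp: einterval_def)
  have deriv: "(?F has_real_derivative ?f u) (at u)" if "ereal 0 < ereal u" for u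
    using that c_pos by (auto intro!: derivative_eq_intros)
  have cont: "isCont ?f u" if "ereal 0 < ereal u" for u
    using that by (auto intro!: continuous_intros)
  have "((\<lambda>u. exp (- (c * u powr \<beta>))) \<longlongrightarrow> 1) (at_right 0)" "((\<lambda>u. exp (- (c * u powr \<beta>))) \<longlongrightarrow> 0) at_top"
    using \<beta>_pos c_pos by real_asymp+
  from this[THEN tendsto_divide[OF _ tendsto_const[of c]], THEN tendsto_minus] c_pos
  have "(?F \<longlongrightarrow> - (1 / c)) (at_right 0)" "(?F \<longlongrightarrow> 0) at_top"
    by simp_all
  then have lims: "((?F \<circ> real_of_ereal) \<longlongrightarrow> - (1 / c)) (at_right (ereal 0))"
      "((?F \<circ> real_of_ereal) \<longlongrightarrow> 0) (at_left \<infinity>)"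
    by (simp_all add: ereal_tendsto_simps)
  have "AE u in lborel. ereal 0 < ereal u \<longrightarrow> ereal u < \<infinity> \<longrightarrow> 0 \<le> ?f u"
    using \<beta>_pos by simp
  from interval_integral_FTC_nonneg[OF _ deriv cont this lims]
  have "set_integrable lborel {0<..} ?f" "(LBINT u=ereal 0..\<infinity>. ?f u) = 0 - - (1 / c)"
    by (auto simp: interval)
  then have "integrable lborel (\<lambda>u. indicator {0<..} u * ?f u)"
      "(\<integral>u. indicator {0<..} u * ?f u \<partial>lborel) = 1 / c"
    by (auto simp: set_integrable_def set_lebesgue_integral_def interval_lebesgue_integral_def interval)
  then have "(\<integral>\<^sup>+u. ennreal (indicator {0<..} u * ?f u) \<partial>lborel) = ennreal (1 / c)"
    using \<beta>_pos by (subst nn_integral_eq_integral) auto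
  moreover have "(\<integral>\<^sup>+u. ennreal (?f u) * indicator {0<..} u \<partial>lborel)
      = (\<integral>\<^sup>+u. ennreal (indicator {0<..} u * ?f u) \<partial>lborel)"
    by (intro nn_integral_cong) (auto simp: indicator_def)
  ultimately show ?thesis
    by simp
qed

lemma nn_integral_exp_minus:
  fixes c :: real
  assumes "0 < c"
  shows "(\<integral>\<^sup>+u. ennreal (exp (- (u * c))) * indicator {0<..} u \<partial>lborel) = ennreal (1 / c)"
proof -
  have "(\<integral>\<^sup>+u. ennreal (exp (- (u * c))) * indicator {0<..} u \<partial>lborel)
      = (\<integral>\<^sup>+u. ennreal (1 * u powr (1 - 1) * exp (- (c * u powr 1))) * indicator {0<..} u \<partial>lborel)"
    by (intro nn_integral_cong) (auto simp: indicator_def mult.commute)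
  also have "\<dots> = ennreal (1 / c)"
    using assms by (intro nn_integral_weibull) auto
  finally show ?thesis .
qed

lemma AE_pair_nonneg_pos:
  assumes "nonneg_distribution M" "nonneg_distribution N" and pos: "AE b in N. 0 < b"
  shows "AE p in M \<Otimes>\<^sub>M N. 0 \<le> fst p \<and> 0 < snd p"
proof -
  interpret M: nonneg_distribution M by fact
  interpret N: nonneg_distribution N by fact
  interpret MN: pair_prob_space M N ..
  have "AE a in M. AE b in N. 0 \<le> fst (a, b) \<and> 0 < snd (a, b)"
    using M.AE_nonneg by eventually_elim (use pos in \<open>auto elim: eventually_mono\<close>)
  then show ?thesis
    by (rule MN.AE_pair_measure[rotated]) measurable
qed

lemma nn_integral_pair_exp_minus:
  assumes "nonneg_distribution M" "nonneg_distribution N" and y_pos: "0 < y" and u_pos: "0 < u"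
  shows "(\<integral>\<^sup>+p. ennreal (y * snd p) * ennreal (exp (- (u * (fst p + y * snd p)))) \<partial>(M \<Otimes>\<^sub>M N))
    = ennreal (laplace_transform M u) * ennreal (y * (\<integral>b. b * exp (- (u * y * b)) \<partial>N))"
proof -
  interpret M: nonneg_distribution M by fact
  interpret N: nonneg_distribution N by fact
  let ?k = "\<lambda>p. ennreal (y * snd p) * ennreal (exp (- (u * (fst p + y * snd p))))"
  let ?h = "\<lambda>b. y * (b * exp (- (u * y * b)))"
  have k_eq: "?k (a, b) = ennreal (exp (- (u * a))) * ennreal (?h b)" for a b
  proof -
    have "?k (a, b) = ennreal (y * b * exp (- (u * (a + y * b))))"
      by (simp add: ennreal_mult'')
    also have "y * b * exp (- (u * (a + y * b))) = exp (- (u * a)) * ?h b"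
      by (simp add: algebra_simps flip: exp_add)
    also have "ennreal \<dots> = ennreal (exp (- (u * a))) * ennreal (?h b)"
      by (rule ennreal_mult') simp
    finally show ?thesis .
  qed
  have "(\<integral>\<^sup>+p. ?k p \<partial>(M \<Otimes>\<^sub>M N)) = (\<integral>\<^sup>+a. \<integral>\<^sup>+b. ?k (a, b) \<partial>N \<partial>M)"
    by (rule N.nn_integral_fst[symmetric]) measurable
  also have "\<dots> = (\<integral>\<^sup>+a. ennreal (exp (- (u * a))) \<partial>M) * (\<integral>\<^sup>+b. ennreal (?h b) \<partial>N)"
    by (simp only: k_eq) (simp add: nn_integral_cmult nn_integral_multc)
  also have "(\<integral>\<^sup>+a. ennreal (exp (- (u * a))) \<partial>M) = ennreal (laplace_transform M u)"
    unfolding laplace_transform_def using u_pos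
    by (intro nn_integral_eq_integral M.integrable_exp_minus) auto
  also have "(\<integral>\<^sup>+b. ennreal (?h b) \<partial>N) = ennreal (y * (\<integral>b. b * exp (- (u * y * b)) \<partial>N))"
    using u_pos y_pos N.AE_nonneg N.integrable_mult_exp_minus[of "u * y"]
    by (subst nn_integral_eq_integral) auto
  finally show ?thesis .
qed

text \<open>\<open>y / (a/b + y) = yb / (a + yb)\<close>, and the reciprocal of \<open>a + yb\<close> is an exponential integral.\<close>
lemma nn_integral_stieltjes_ratio:
  assumes nonneg_M: "nonneg_distribution M" and nonneg_N: "nonneg_distribution N"
    and pos: "AE b in N. 0 < b" and y_pos: "0 < y"
  shows "(\<integral>\<^sup>+p. ennreal (y / (fst p / snd p + y)) \<partial>(M \<Otimes>\<^sub>M N))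
    = (\<integral>\<^sup>+u. ennreal (laplace_transform M u) * ennreal (y * (\<integral>b. b * exp (- (u * y * b)) \<partial>N))
        * indicator {0<..} u \<partial>lborel)" (is "_ = ?rhs")
proof -
  interpret M: nonneg_distribution M by fact
  interpret N: nonneg_distribution N by fact
  interpret MN: pair_prob_space M N ..
  interpret MNL: pair_sigma_finite "M \<Otimes>\<^sub>M N" lborel ..
  let ?k = "\<lambda>p u. ennreal (y * snd p) * (ennreal (exp (- (u * (fst p + y * snd p)))) * indicator {0<..} u)"
  have "AE p in M \<Otimes>\<^sub>M N. ennreal (y / (fst p / snd p + y)) = (\<integral>\<^sup>+u. ?k p u \<partial>lborel)"
    using AE_pair_nonneg_pos[OF nonneg_M nonneg_N pos]
  proof eventually_elim
    case (elim p)
    then have "(\<integral>\<^sup>+u. ?k p u \<partial>lborel) = ennreal (y * snd p) * ennreal (1 / (fst p + y * snd p))"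
      using y_pos by (subst nn_integral_cmult) (auto simp: nn_integral_exp_minus add_nonneg_pos)
    also have "\<dots> = ennreal (y / (fst p / snd p + y))"
      using elim y_pos by (subst ennreal_mult''[symmetric]) (auto simp: field_simps)
    finally show ?case by simp
  qed
  then have "(\<integral>\<^sup>+p. ennreal (y / (fst p / snd p + y)) \<partial>(M \<Otimes>\<^sub>M N)) = (\<integral>\<^sup>+p. \<integral>\<^sup>+u. ?k p u \<partial>lborel \<partial>(M \<Otimes>\<^sub>M N))"
    by (rule nn_integral_cong_AE)
  also have "\<dots> = (\<integral>\<^sup>+u. \<integral>\<^sup>+p. ?k p u \<partial>(M \<Otimes>\<^sub>M N) \<partial>lborel)"
    by (rule MNL.Fubini'[symmetric]) measurable
  also have "\<dots> = ?rhs"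
    using nn_integral_pair_exp_minus[OF nonneg_M nonneg_N y_pos]
    by (intro nn_integral_cong) (auto simp: indicator_def)
  finally show ?thesis .
qed

context positive_stable_distribution
begin

lemma AE_pos: "AE x in M. 0 < x"
proof (rule AE_pos_if_laplace_transform_vanishes)
  have "((\<lambda>l. exp (- (l powr \<beta>))) \<longlongrightarrow> 0) at_top"
    using exponent_pos by real_asymp
  moreover have "eventually (\<lambda>l. exp (- (l powr \<beta>)) = laplace_transform M l) at_top"
    using eventually_gt_at_top[of 0] by eventually_elim (simp add: laplace_transform_eq)
  ultimately show "(laplace_transform M \<longlongrightarrow> 0) at_top"
    using tendsto_cong by force
qed

lemma integral_mult_exp_minus_eq:
  assumes "0 < u"
  shows "(\<integral>x. x * exp (- (u * x)) \<partial>M) = \<beta> * u powr (\<beta> - 1) * exp (- (u powr \<beta>))"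
proof -
  have "((\<lambda>l. exp (- (l powr \<beta>))) has_real_derivative - (\<beta> * u powr (\<beta> - 1)) * exp (- (u powr \<beta>))) (at u)"
    using assms by (auto intro!: derivative_eq_intros)
  then have "(laplace_transform M has_real_derivative - (\<beta> * u powr (\<beta> - 1)) * exp (- (u powr \<beta>))) (at u)"
    by (rule has_field_derivative_transform_within_open[where S = "{0<..}"])
       (use assms laplace_transform_eq in auto)
  from DERIV_unique[OF laplace_transform_has_real_derivative[OF assms] this] show ?thesis
    by simp
qed

lemma laplace_transform_mult_integral_eq:
  assumes "0 < u" "0 < y"
  shows "laplace_transform M u * (y * (\<integral>b. b * exp (- (u * y * b)) \<partial>M))
    = y powr \<beta> * (\<beta> * u powr (\<beta> - 1) * exp (- ((1 + y powr \<beta>) * u powr \<beta>)))"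
proof -
  have "exp (- (u powr \<beta>)) * exp (- ((u * y) powr \<beta>)) = exp (- ((1 + y powr \<beta>) * u powr \<beta>))"
    using assms by (simp add: powr_mult algebra_simps flip: exp_add)
  moreover have "y * (u * y) powr (\<beta> - 1) = y powr \<beta> * u powr (\<beta> - 1)"
    using assms by (simp add: powr_mult powr_diff)
  moreover have "laplace_transform M u * (y * (\<integral>b. b * exp (- (u * y * b)) \<partial>M))
      = (y * (u * y) powr (\<beta> - 1)) * \<beta> * (exp (- (u powr \<beta>)) * exp (- ((u * y) powr \<beta>)))"
    using assms by (subst laplace_transform_eq, simp, subst integral_mult_exp_minus_eq) simp_all
  ultimately show ?thesis
    by (simp only: mult_ac)
qed

lemma AE_ratio_nonneg: "AE p in M \<Otimes>\<^sub>M M. 0 \<le> fst p / snd p"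
  using AE_pair_nonneg_pos[OF nonneg_distribution_axioms nonneg_distribution_axioms AE_pos]
  by eventually_elim simp

lemma ratio_stieltjes_transform:
  assumes y_pos: "0 < y"
  shows "(\<integral>p. y / (fst p / snd p + y) \<partial>(M \<Otimes>\<^sub>M M)) = y powr \<beta> / (1 + y powr \<beta>)"
proof -
  let ?m = "\<lambda>u. y * (\<integral>b. b * exp (- (u * y * b)) \<partial>M)"
  let ?w = "\<lambda>u. \<beta> * u powr (\<beta> - 1) * exp (- ((1 + y powr \<beta>) * u powr \<beta>))"
  have "(\<integral>\<^sup>+p. ennreal (y / (fst p / snd p + y)) \<partial>(M \<Otimes>\<^sub>M M))
      = (\<integral>\<^sup>+u. ennreal (laplace_transform M u) * ennreal (?m u) * indicator {0<..} u \<partial>lborel)"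
    by (rule nn_integral_stieltjes_ratio[OF nonneg_distribution_axioms nonneg_distribution_axioms AE_pos y_pos])
  also have "\<dots> = (\<integral>\<^sup>+u. ennreal (y powr \<beta>) * (ennreal (?w u) * indicator {0<..} u) \<partial>lborel)"
  proof (intro nn_integral_cong)
    fix u :: real
    have "0 \<le> laplace_transform M u"
      by (simp add: laplace_transform_def)
    then show "ennreal (laplace_transform M u) * ennreal (?m u) * indicator {0<..} u
        = ennreal (y powr \<beta>) * (ennreal (?w u) * indicator {0<..} u)"
      using laplace_transform_mult_integral_eq[OF _ y_pos, of u]
      by (cases "0 < u") (simp_all flip: ennreal_mult')
  qed
  also have "\<dots> = ennreal (y powr \<beta>) * ennreal (1 / (1 + y powr \<beta>))"
    using exponent_pos by (subst nn_integral_cmult) (auto simp: nn_integral_weibull add_pos_nonneg)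
  also have "\<dots> = ennreal (y powr \<beta> / (1 + y powr \<beta>))"
    by (simp flip: ennreal_mult')
  finally have nn_integral_eq: "(\<integral>\<^sup>+p. ennreal (y / (fst p / snd p + y)) \<partial>(M \<Otimes>\<^sub>M M))
      = ennreal (y powr \<beta> / (1 + y powr \<beta>))" .
  have "AE p in M \<Otimes>\<^sub>M M. 0 \<le> y / (fst p / snd p + y)"
    using AE_ratio_nonneg by eventually_elim (use y_pos in simp)
  then show ?thesis
    by (intro integral_eq_nn_integral[THEN trans]) (auto simp: nn_integral_eq)
qed

definition ratio_cdf :: "real \<Rightarrow> real" where
  "ratio_cdf y = measure (M \<Otimes>\<^sub>M M) {p \<in> space (M \<Otimes>\<^sub>M M). fst p / snd p \<le> y}"

lemma ratio_cdf_nonneg: "0 \<le> ratio_cdf y"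
  by (simp add: ratio_cdf_def)

lemma sector_angle_le_ratio_cdf:
  assumes "\<beta> < 1" "0 < y"
  shows "sector_angle (\<beta> * pi) (y powr \<beta>) \<le> \<beta> * pi * ratio_cdf y"
proof -
  interpret MM: pair_prob_space M M ..
  show ?thesis
    unfolding ratio_cdf_def using exponent_pos assms AE_ratio_nonneg ratio_stieltjes_transform
    by (intro MM.sector_angle_le_prob) simp_all
qed

lemma ratio_cdf_scale_sum_ge:
  assumes \<beta>_less_half: "\<beta> < 1 / 2" and \<delta>_range: "0 < \<delta>" "\<delta> \<le> 1" and k_pos: "0 < k"
  defines "t \<equiv> \<delta> powr (2 * \<beta> / (1 - 2 * \<beta>))"
  shows "2 * (t / (1 + t)) \<le> ratio_cdf (\<delta>\<^sup>2 * k) + ratio_cdf (\<delta>\<^sup>2 / k)"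
proof -
  define c where "c = \<beta> * pi"
  define X where "X = \<delta> powr (2 * \<beta>)"
  have c_range: "0 < c" "c < pi / 2" and exponent: "1 - 2 * c / pi = 1 - 2 * \<beta>"
    using exponent_pos \<beta>_less_half by (auto simp: c_def field_simps)
  have t_range: "0 < t" "t \<le> 1" using \<delta>_range \<beta>_less_half exponent_pos by (auto simp: t_def powr_le1)
  have X_props: "0 < X" "X \<le> 1" "t powr (1 - 2 * \<beta>) = X"
    using \<delta>_range \<beta>_less_half exponent_pos by (auto simp: X_def t_def powr_le1 powr_powr)
  have "\<delta>\<^sup>2 = \<delta> powr 2" using \<delta>_range by simp
  then have \<delta>_powr: "(\<delta>\<^sup>2) powr \<beta> = X" by (simp only: X_def powr_powr)
  have angle_le: "sector_angle c (y powr \<beta>) \<le> c * ratio_cdf y" if "0 < y" for y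
    unfolding c_def using \<beta>_less_half that by (intro sector_angle_le_ratio_cdf) auto
  have "c * (t / (1 + t)) \<le> sector_angle c X"
    using le_sector_angle[OF c_range t_range] by (simp only: exponent X_props(3))
  then have "c * (2 * (t / (1 + t))) \<le> 2 * sector_angle c X"
    by (subst mult.left_commute) linarith
  also have "\<dots> \<le> sector_angle c (X * k powr \<beta>) + sector_angle c (X / k powr \<beta>)"
    using k_pos c_range by (intro sector_angle_scale_ge X_props) auto
  also have "\<dots> \<le> c * ratio_cdf (\<delta>\<^sup>2 * k) + c * ratio_cdf (\<delta>\<^sup>2 / k)"
    using angle_le[of "\<delta>\<^sup>2 * k"] angle_le[of "\<delta>\<^sup>2 / k"] \<delta>_range k_pos
    by (simp add: powr_mult powr_divide \<delta>_powr)
  also have "\<dots> = c * (ratio_cdf (\<delta>\<^sup>2 * k) + ratio_cdf (\<delta>\<^sup>2 / k))"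
    by (simp add: algebra_simps)
  finally show ?thesis
    using c_range(1) by (simp only: mult_le_cancel_left_pos)
qed

end

subsection \<open>The ratio of two symmetric stable variables\<close>

lemma (in positive_stable_distribution) sym_stable_eq_normal_mixture:
  assumes stable_\<mu>: "real_distribution \<mu>" "sym_stable (2 * \<beta>) \<mu>"
  shows "\<mu> = distr (M \<Otimes>\<^sub>M std_normal_distribution) borel (\<lambda>p. sqrt (2 * fst p) * snd p)"
proof (rule Levy_uniqueness[OF stable_\<mu>(1)])
  interpret \<gamma>: real_distribution std_normal_distribution by (rule real_dist_normal_dist)
  interpret P: pair_prob_space M std_normal_distribution ..
  let ?D = "distr (M \<Otimes>\<^sub>M std_normal_distribution) borel (\<lambda>p. sqrt (2 * fst p) * snd p)"
  show "real_distribution ?D"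
    by (intro P.real_distribution_distr) measurable
  show "char \<mu> = char ?D"
  proof
    fix t
    have "char ?D t = (\<integral>p. iexp (t * (sqrt (2 * fst p) * snd p)) \<partial>(M \<Otimes>\<^sub>M std_normal_distribution))"
      unfolding char_def by (intro integral_distr) measurable
    also have "\<dots> = (\<integral>a. (\<integral>g. iexp (t * (sqrt (2 * a) * g)) \<partial>std_normal_distribution) \<partial>M)"
      by (subst P.integral_fst'[symmetric]) (auto intro!: P.integrable_const_bound[where B = 1])
    also have "\<dots> = (\<integral>a. char std_normal_distribution (t * sqrt (2 * a)) \<partial>M)"
      unfolding char_def by (simp add: mult.assoc)
    also have "\<dots> = (\<integral>a. complex_of_real (exp (- (t\<^sup>2 * a))) \<partial>M)"
    proof (rule integral_cong_AE)
      show "AE a in M. char std_normal_distribution (t * sqrt (2 * a)) = complex_of_real (exp (- (t\<^sup>2 * a)))"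
        using AE_nonneg by eventually_elim (simp add: char_std_normal_distribution power_mult_distrib)
    qed (simp_all add: char_std_normal_distribution)
    also have "\<dots> = complex_of_real (laplace_transform M (t\<^sup>2))"
      by (simp add: laplace_transform_def)
    also have "laplace_transform M (t\<^sup>2) = exp (- (\<bar>t\<bar> powr (2 * \<beta>)))"
    proof (cases "t = 0")
      case True
      then show ?thesis using prob_space by (simp add: laplace_transform_def)
    next
      case False
      then have "t\<^sup>2 = \<bar>t\<bar> powr 2" by simp
      then have "(t\<^sup>2) powr \<beta> = \<bar>t\<bar> powr (2 * \<beta>)" by (simp only: powr_powr)
      with False show ?thesis by (simp add: laplace_transform_eq)
    qed
    finally show "char \<mu> t = char ?D t"
      using stable_\<mu>(2) by (simp add: sym_stable_def)
  qed
qed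

lemma nn_integral_pair_distr_pair:
  assumes "prob_space M" "prob_space N"
    and [measurable]: "m \<in> measurable (M \<Otimes>\<^sub>M N) K" "f \<in> borel_measurable (K \<Otimes>\<^sub>M K)"
  defines "D \<equiv> distr (M \<Otimes>\<^sub>M N) K m"
  shows "(\<integral>\<^sup>+z. f z \<partial>(D \<Otimes>\<^sub>M D))
    = (\<integral>\<^sup>+q. \<integral>\<^sup>+p. f (m (fst p, fst q), m (snd p, snd q)) \<partial>(M \<Otimes>\<^sub>M M) \<partial>(N \<Otimes>\<^sub>M N))"
proof -
  interpret M: prob_space M by fact
  interpret N: prob_space N by fact
  interpret MN: pair_prob_space M N ..
  interpret NM: pair_prob_space N M ..
  interpret MM: pair_prob_space M M ..
  interpret D: prob_space D unfolding D_def by (rule MN.prob_space_distr) measurable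
  have [measurable_cong]: "sets D = sets K" by (simp add: D_def)
  have distr_eq: "(\<integral>\<^sup>+z. g z \<partial>D) = (\<integral>\<^sup>+a. \<integral>\<^sup>+b. g (m (a, b)) \<partial>N \<partial>M)" if [measurable]: "g \<in> borel_measurable K" for g
    unfolding D_def by (simp add: nn_integral_distr N.nn_integral_fst[symmetric])
  have "(\<integral>\<^sup>+z. f z \<partial>(D \<Otimes>\<^sub>M D)) = (\<integral>\<^sup>+x. \<integral>\<^sup>+y. f (x, y) \<partial>D \<partial>D)"
    by (rule D.nn_integral_fst[symmetric]) measurable
  also have "\<dots> = (\<integral>\<^sup>+x. \<integral>\<^sup>+b. \<integral>\<^sup>+h. f (x, m (b, h)) \<partial>N \<partial>M \<partial>D)"
    by (intro nn_integral_cong distr_eq) (simp add: D_def)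
  also have "\<dots> = (\<integral>\<^sup>+a. \<integral>\<^sup>+g. \<integral>\<^sup>+b. \<integral>\<^sup>+h. f (m (a, g), m (b, h)) \<partial>N \<partial>M \<partial>N \<partial>M)"
    by (rule distr_eq) measurable
  also have "\<dots> = (\<integral>\<^sup>+a. \<integral>\<^sup>+g. \<integral>\<^sup>+h. \<integral>\<^sup>+b. f (m (a, g), m (b, h)) \<partial>M \<partial>N \<partial>N \<partial>M)"
    by (intro nn_integral_cong NM.Fubini') measurable
  also have "\<dots> = (\<integral>\<^sup>+g. \<integral>\<^sup>+a. \<integral>\<^sup>+h. \<integral>\<^sup>+b. f (m (a, g), m (b, h)) \<partial>M \<partial>N \<partial>M \<partial>N)"
    by (rule NM.Fubini') measurable
  also have "\<dots> = (\<integral>\<^sup>+g. \<integral>\<^sup>+h. \<integral>\<^sup>+a. \<integral>\<^sup>+b. f (m (a, g), m (b, h)) \<partial>M \<partial>M \<partial>N \<partial>N)"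
    by (intro nn_integral_cong NM.Fubini') measurable
  also have "\<dots> = (\<integral>\<^sup>+g. \<integral>\<^sup>+h. \<integral>\<^sup>+p. f (m (fst p, g), m (snd p, h)) \<partial>(M \<Otimes>\<^sub>M M) \<partial>N \<partial>N)"
    by (intro nn_integral_cong) (subst M.nn_integral_fst[symmetric], simp_all)
  also have "\<dots> = (\<integral>\<^sup>+q. \<integral>\<^sup>+p. f (m (fst p, fst q), m (snd p, snd q)) \<partial>(M \<Otimes>\<^sub>M M) \<partial>(N \<Otimes>\<^sub>M N))"
    by (subst N.nn_integral_fst[symmetric]) simp_all
  finally show ?thesis .
qed

lemma (in prob_space) nn_integral_pair_ge_if_symmetrized_ge:
  fixes c :: ennreal
  assumes [measurable]: "f \<in> borel_measurable (M \<Otimes>\<^sub>M M)"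
    and ge: "AE p in M \<Otimes>\<^sub>M M. 2 * c \<le> f p + f (snd p, fst p)"
  shows "c \<le> (\<integral>\<^sup>+p. f p \<partial>(M \<Otimes>\<^sub>M M))"
proof -
  interpret MM: pair_prob_space M M ..
  have swap: "(\<integral>\<^sup>+p. f (snd p, fst p) \<partial>(M \<Otimes>\<^sub>M M)) = (\<integral>\<^sup>+p. f p \<partial>(M \<Otimes>\<^sub>M M))"
    by (subst (2) MM.distr_pair_swap) (simp add: nn_integral_distr case_prod_beta)
  have "2 * c = (\<integral>\<^sup>+p. 2 * c \<partial>(M \<Otimes>\<^sub>M M))"
    by (simp add: MM.emeasure_space_1)
  also have "\<dots> \<le> (\<integral>\<^sup>+p. f p + f (snd p, fst p) \<partial>(M \<Otimes>\<^sub>M M))"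
    by (rule nn_integral_mono_AE[OF ge])
  also have "\<dots> = 2 * (\<integral>\<^sup>+p. f p \<partial>(M \<Otimes>\<^sub>M M))"
    by (simp add: nn_integral_add swap mult_2)
  finally show ?thesis
    by (simp add: ennreal_mult_le_mult_iff)
qed

lemma AE_std_normal_nonzero: "AE x in std_normal_distribution. x \<noteq> 0"
  by (subst AE_density) (use AE_lborel_singleton[of 0] in \<open>auto elim: eventually_mono\<close>)

lemma abs_sqrt_mult_le_iff:
  assumes "0 \<le> a" "0 < b" "0 \<le> \<delta>" "g \<noteq> 0"
  shows "\<bar>sqrt (2 * a) * g\<bar> \<le> \<delta> * \<bar>sqrt (2 * b) * h\<bar> \<longleftrightarrow> a / b \<le> \<delta>\<^sup>2 * (h\<^sup>2 / g\<^sup>2)"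
proof -
  have "\<bar>sqrt (2 * a) * g\<bar> \<le> \<delta> * \<bar>sqrt (2 * b) * h\<bar> \<longleftrightarrow> sqrt (2 * a * g\<^sup>2) \<le> sqrt (\<delta>\<^sup>2 * (2 * b * h\<^sup>2))"
    using assms by (simp add: real_sqrt_mult abs_mult)
  also have "\<dots> \<longleftrightarrow> a * g\<^sup>2 \<le> \<delta>\<^sup>2 * (b * h\<^sup>2)"
    by (simp add: algebra_simps)
  also have "\<dots> \<longleftrightarrow> a / b \<le> \<delta>\<^sup>2 * (h\<^sup>2 / g\<^sup>2)"
    using assms by (simp add: field_simps)
  finally show ?thesis .
qed

definition ratio_event :: "real \<Rightarrow> (real \<times> real) set" where
  "ratio_event \<delta> = {p. \<bar>fst p\<bar> \<le> \<delta> * \<bar>snd p\<bar>}"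

lemma ratio_event_measurable [measurable]: "ratio_event \<delta> \<in> sets (borel \<Otimes>\<^sub>M borel)"
proof -
  have "{p \<in> space (borel \<Otimes>\<^sub>M borel). \<bar>fst p\<bar> \<le> \<delta> * \<bar>snd p\<bar>} \<in> sets (borel \<Otimes>\<^sub>M borel)"
    by measurable
  then show ?thesis by (simp add: ratio_event_def space_pair_measure)
qed

context positive_stable_distribution
begin

text \<open>The pair \<open>z\<close> holds the normal factors on which the ratio event is conditioned.\<close>

definition conditional_ratio_prob :: "real \<Rightarrow> real \<times> real \<Rightarrow> ennreal" where
  "conditional_ratio_prob \<delta> z
    = (\<integral>\<^sup>+p. indicator (ratio_event \<delta>) (sqrt (2 * fst p) * fst z, sqrt (2 * snd p) * snd z) \<partial>(M \<Otimes>\<^sub>M M))"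

lemma conditional_ratio_prob_eq:
  assumes "0 \<le> \<delta>" "g \<noteq> 0"
  shows "conditional_ratio_prob \<delta> (g, h) = ennreal (ratio_cdf (\<delta>\<^sup>2 * (h\<^sup>2 / g\<^sup>2)))"
proof -
  interpret MM: pair_prob_space M M ..
  let ?A = "{p \<in> space (M \<Otimes>\<^sub>M M). fst p / snd p \<le> \<delta>\<^sup>2 * (h\<^sup>2 / g\<^sup>2)}"
  have "AE p in M \<Otimes>\<^sub>M M. indicator (ratio_event \<delta>) (sqrt (2 * fst p) * g, sqrt (2 * snd p) * h)
      = (indicator ?A p :: ennreal)"
    using AE_pair_nonneg_pos[OF nonneg_distribution_axioms nonneg_distribution_axioms AE_pos] AE_space
  proof eventually_elim
    case (elim p)
    then show ?case
      using abs_sqrt_mult_le_iff[of "fst p" "snd p" \<delta> g h] assms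
      by (simp add: ratio_event_def indicator_def)
  qed
  then have "conditional_ratio_prob \<delta> (g, h) = (\<integral>\<^sup>+p. indicator ?A p \<partial>(M \<Otimes>\<^sub>M M))"
    unfolding conditional_ratio_prob_def fst_conv snd_conv by (rule nn_integral_cong_AE)
  also have "\<dots> = emeasure (M \<Otimes>\<^sub>M M) ?A"
    by (rule nn_integral_indicator) measurable
  finally show ?thesis
    by (simp add: ratio_cdf_def MM.emeasure_eq_measure)
qed

lemma conditional_ratio_prob_symmetrized_ge:
  assumes \<beta>_less_half: "\<beta> < 1 / 2" and \<delta>_range: "0 < \<delta>" "\<delta> \<le> 1" and "g \<noteq> 0" "h \<noteq> 0"
  defines "t \<equiv> \<delta> powr (2 * \<beta> / (1 - 2 * \<beta>))"
  shows "2 * ennreal (t / (1 + t)) \<le> conditional_ratio_prob \<delta> (g, h) + conditional_ratio_prob \<delta> (h, g)"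
proof -
  have "2 * (t / (1 + t)) \<le> ratio_cdf (\<delta>\<^sup>2 * (h\<^sup>2 / g\<^sup>2)) + ratio_cdf (\<delta>\<^sup>2 * (g\<^sup>2 / h\<^sup>2))"
    using ratio_cdf_scale_sum_ge[OF \<beta>_less_half \<delta>_range, of "h\<^sup>2 / g\<^sup>2"] assms(4,5) by (simp add: t_def)
  then have "ennreal (2 * (t / (1 + t))) \<le> ennreal (ratio_cdf (\<delta>\<^sup>2 * (h\<^sup>2 / g\<^sup>2)) + ratio_cdf (\<delta>\<^sup>2 * (g\<^sup>2 / h\<^sup>2)))"
    by (rule ennreal_leI)
  also have "\<dots> = conditional_ratio_prob \<delta> (g, h) + conditional_ratio_prob \<delta> (h, g)"
    using \<delta>_range assms(4,5) by (simp add: conditional_ratio_prob_eq ratio_cdf_nonneg)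
  finally show ?thesis
    by (subst (asm) ennreal_mult') simp_all
qed

lemma borel_measurable_conditional_ratio_prob [measurable]:
  "conditional_ratio_prob \<delta> \<in> borel_measurable (borel \<Otimes>\<^sub>M borel)"
proof -
  interpret MM: pair_prob_space M M ..
  show ?thesis
    unfolding conditional_ratio_prob_def[abs_def] by measurable
qed

lemma emeasure_ratio_event_eq:
  assumes "real_distribution \<mu>" "sym_stable (2 * \<beta>) \<mu>"
  shows "emeasure (\<mu> \<Otimes>\<^sub>M \<mu>) (ratio_event \<delta>)
    = (\<integral>\<^sup>+z. conditional_ratio_prob \<delta> z \<partial>(std_normal_distribution \<Otimes>\<^sub>M std_normal_distribution))"
proof -
  interpret \<gamma>: real_distribution std_normal_distribution by (rule real_dist_normal_dist)
  interpret \<mu>: real_distribution \<mu> by fact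
  have law: "\<mu> = distr (M \<Otimes>\<^sub>M std_normal_distribution) borel (\<lambda>p. sqrt (2 * fst p) * snd p)"
    by (rule sym_stable_eq_normal_mixture[OF assms])
  have mixture: "(\<lambda>p. sqrt (2 * fst p) * snd p) \<in> borel_measurable (M \<Otimes>\<^sub>M std_normal_distribution)"
    by measurable
  have "emeasure (\<mu> \<Otimes>\<^sub>M \<mu>) (ratio_event \<delta>) = (\<integral>\<^sup>+z. indicator (ratio_event \<delta>) z \<partial>(\<mu> \<Otimes>\<^sub>M \<mu>))"
    by (rule nn_integral_indicator[symmetric]) measurable
  also have "\<dots> = (\<integral>\<^sup>+z. conditional_ratio_prob \<delta> z \<partial>(std_normal_distribution \<Otimes>\<^sub>M std_normal_distribution))"
    using nn_integral_pair_distr_pair[OF prob_space_axioms \<gamma>.prob_space_axioms mixture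
        borel_measurable_indicator[OF ratio_event_measurable]]
    by (simp add: conditional_ratio_prob_def flip: law)
  finally show ?thesis .
qed

lemma emeasure_ratio_event_ge:
  assumes "real_distribution \<mu>" "sym_stable (2 * \<beta>) \<mu>"
    and \<beta>_less_half: "\<beta> < 1 / 2" and \<delta>_range: "0 < \<delta>" "\<delta> \<le> 1"
  defines "t \<equiv> \<delta> powr (2 * \<beta> / (1 - 2 * \<beta>))"
  shows "ennreal (t / (1 + t)) \<le> emeasure (\<mu> \<Otimes>\<^sub>M \<mu>) (ratio_event \<delta>)"
  unfolding emeasure_ratio_event_eq[OF assms(1,2)]
proof -
  interpret \<gamma>: real_distribution std_normal_distribution by (rule real_dist_normal_dist)
  interpret \<gamma>\<gamma>: pair_prob_space std_normal_distribution std_normal_distribution ..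
  show "ennreal (t / (1 + t))
    \<le> (\<integral>\<^sup>+z. conditional_ratio_prob \<delta> z \<partial>(std_normal_distribution \<Otimes>\<^sub>M std_normal_distribution))"
  proof (rule \<gamma>.nn_integral_pair_ge_if_symmetrized_ge)
    show "conditional_ratio_prob \<delta> \<in> borel_measurable (std_normal_distribution \<Otimes>\<^sub>M std_normal_distribution)"
      by measurable
    have "AE g in std_normal_distribution. AE h in std_normal_distribution. fst (g, h) \<noteq> 0 \<and> snd (g, h) \<noteq> 0"
      using AE_std_normal_nonzero by eventually_elim (use AE_std_normal_nonzero in auto)
    then have "AE z in std_normal_distribution \<Otimes>\<^sub>M std_normal_distribution. fst z \<noteq> 0 \<and> snd z \<noteq> 0"
      by (rule \<gamma>\<gamma>.AE_pair_measure[rotated]) measurable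
    then show "AE z in std_normal_distribution \<Otimes>\<^sub>M std_normal_distribution.
        2 * ennreal (t / (1 + t)) \<le> conditional_ratio_prob \<delta> z + conditional_ratio_prob \<delta> (snd z, fst z)"
      unfolding t_def
      by eventually_elim (use conditional_ratio_prob_symmetrized_ge[OF \<beta>_less_half \<delta>_range] in force)
  qed
qed

end

lemma sym_stable_ratio_prob_ge:
  assumes \<alpha>_range: "0 < \<alpha>" "\<alpha> < 1" and stable_\<mu>: "real_distribution \<mu>" "sym_stable \<alpha> \<mu>"
    and \<delta>_range: "0 < \<delta>" "\<delta> \<le> 1"
  defines "t \<equiv> \<delta> powr (\<alpha> / (1 - \<alpha>))"
  shows "t / (1 + t) \<le> measure (\<mu> \<Otimes>\<^sub>M \<mu>) (ratio_event \<delta>)"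
proof -
  obtain \<nu> where "positive_stable_distribution \<nu> (\<alpha> / 2)"
    using positive_stable_distribution_exists[of "\<alpha> / 2"] \<alpha>_range by auto
  then interpret \<nu>: positive_stable_distribution \<nu> "\<alpha> / 2" .
  interpret \<mu>: real_distribution \<mu> by (rule stable_\<mu>)
  interpret \<mu>\<mu>: pair_prob_space \<mu> \<mu> ..
  have "ennreal (t / (1 + t)) \<le> emeasure (\<mu> \<Otimes>\<^sub>M \<mu>) (ratio_event \<delta>)"
    using \<nu>.emeasure_ratio_event_ge[OF stable_\<mu>(1) _ _ \<delta>_range] stable_\<mu>(2) \<alpha>_range by (simp add: t_def)
  then show ?thesis
    by (simp add: \<mu>\<mu>.emeasure_eq_measure)
qed

subsection \<open>The absolute minimum estimator\<close>

lemma (in prob_space) char_distr_cmult: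
  assumes [measurable]: "random_variable borel X"
  shows "char (distr M borel (\<lambda>\<omega>. a * X \<omega>)) t = char (distr M borel X) (t * a)"
  unfolding char_def by (simp add: integral_distr mult_ac)

lemma sym_stable_unique:
  assumes "real_distribution \<mu>" "real_distribution \<mu>'" "sym_stable \<alpha> \<mu>" "sym_stable \<alpha> \<mu>'"
  shows "\<mu> = \<mu>'"
  using assms by (intro Levy_uniqueness) (auto simp: sym_stable_def)

lemma (in prob_space) sym_stable_linear_combination:
  assumes "finite I" and indep: "indep_vars (\<lambda>_. borel) X I"
    and stable: "\<And>p. p \<in> I \<Longrightarrow> sym_stable \<alpha> (distr M borel (X p))"
    and norm: "(\<Sum>p\<in>I. \<bar>a p\<bar> powr \<alpha>) = 1"
  shows "sym_stable \<alpha> (distr M borel (\<lambda>\<omega>. \<Sum>p\<in>I. a p * X p \<omega>))"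
  unfolding sym_stable_def
proof
  fix t
  have X_measurable: "random_variable borel (X p)" if "p \<in> I" for p
    using indep that by (auto simp: indep_vars_def)
  have "char (distr M borel (\<lambda>\<omega>. \<Sum>p\<in>I. a p * X p \<omega>)) t = (\<Prod>p\<in>I. char (distr M borel (\<lambda>\<omega>. a p * X p \<omega>)) t)"
    by (intro char_distr_sum indep_vars_compose2[OF indep]) auto
  also have "\<dots> = (\<Prod>p\<in>I. complex_of_real (exp (- (\<bar>a p\<bar> powr \<alpha> * \<bar>t\<bar> powr \<alpha>))))"
  proof (intro prod.cong refl)
    fix p assume "p \<in> I"
    then show "char (distr M borel (\<lambda>\<omega>. a p * X p \<omega>)) t = complex_of_real (exp (- (\<bar>a p\<bar> powr \<alpha> * \<bar>t\<bar> powr \<alpha>)))"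
      using stable[of p]
      by (simp add: char_distr_cmult[OF X_measurable] sym_stable_def abs_mult powr_mult mult.commute)
  qed
  also have "\<dots> = complex_of_real (exp (\<Sum>p\<in>I. - (\<bar>a p\<bar> powr \<alpha> * \<bar>t\<bar> powr \<alpha>)))"
    using \<open>finite I\<close> by (simp add: exp_sum)
  also have "(\<Sum>p\<in>I. - (\<bar>a p\<bar> powr \<alpha> * \<bar>t\<bar> powr \<alpha>)) = - (\<bar>t\<bar> powr \<alpha>)"
    using norm by (simp add: sum_negf flip: sum_distrib_right)
  finally show "char (distr M borel (\<lambda>\<omega>. \<Sum>p\<in>I. a p * X p \<omega>)) t = complex_of_real (exp (- (\<bar>t\<bar> powr \<alpha>)))" .
qed

lemma (in prob_space) sym_stable_ratio_exceeds_prob_le: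
  assumes \<alpha>_range: "0 < \<alpha>" "\<alpha> < 1"
    and indep: "indep_var borel Y borel S"
    and stable_Y: "sym_stable \<alpha> (distr M borel Y)" and stable_S: "sym_stable \<alpha> (distr M borel S)"
    and \<delta>_range: "0 < \<delta>" "\<delta> \<le> 1"
  shows "prob {\<omega> \<in> space M. \<delta> * \<bar>S \<omega>\<bar> < \<bar>Y \<omega>\<bar>} \<le> 1 / (1 + \<delta> powr (\<alpha> / (1 - \<alpha>)))"
proof -
  have [measurable]: "random_variable borel Y" "random_variable borel S"
    using indep by (auto dest: indep_var_rv1 indep_var_rv2)
  define \<mu> where "\<mu> = distr M borel S"
  define t where "t = \<delta> powr (\<alpha> / (1 - \<alpha>))"
  have stable_\<mu>: "real_distribution \<mu>" "sym_stable \<alpha> \<mu>"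
    unfolding \<mu>_def using stable_S by auto
  have "distr M borel Y = \<mu>"
    by (rule sym_stable_unique[OF _ stable_\<mu>(1) stable_Y stable_\<mu>(2)]) auto
  with indep have joint: "distr M (borel \<Otimes>\<^sub>M borel) (\<lambda>\<omega>. (Y \<omega>, S \<omega>)) = \<mu> \<Otimes>\<^sub>M \<mu>"
    unfolding indep_var_distribution_eq \<mu>_def by simp
  let ?C = "{\<omega> \<in> space M. \<bar>Y \<omega>\<bar> \<le> \<delta> * \<bar>S \<omega>\<bar>}"
  have "t / (1 + t) \<le> measure (\<mu> \<Otimes>\<^sub>M \<mu>) (ratio_event \<delta>)"
    unfolding t_def by (rule sym_stable_ratio_prob_ge[OF \<alpha>_range stable_\<mu> \<delta>_range])
  also have "\<dots> = prob ((\<lambda>\<omega>. (Y \<omega>, S \<omega>)) -` ratio_event \<delta> \<inter> space M)"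
    unfolding joint[symmetric] by (intro measure_distr) measurable
  also have "(\<lambda>\<omega>. (Y \<omega>, S \<omega>)) -` ratio_event \<delta> \<inter> space M = ?C"
    by (auto simp: ratio_event_def)
  finally have "t / (1 + t) \<le> prob ?C" .
  moreover have "prob (space M - ?C) = 1 - prob ?C"
    by (rule prob_compl) measurable
  moreover have "space M - ?C = {\<omega> \<in> space M. \<delta> * \<bar>S \<omega>\<bar> < \<bar>Y \<omega>\<bar>}"
    by auto
  moreover have "1 - t / (1 + t) = 1 / (1 + t)"
  proof -
    have "0 < 1 + t" by (simp add: t_def add_pos_nonneg)
    then show ?thesis by (simp add: field_simps)
  qed
  ultimately show ?thesis by (simp add: t_def)
qed

lemma (in prob_space) sym_stable_linear_combination_exceeds_prob_le:
  fixes a :: "'i \<Rightarrow> real"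
  assumes \<alpha>_range: "0 < \<alpha>" "\<alpha> < 1" and "finite I" and indep: "indep_vars (\<lambda>_. borel) X I"
    and stable: "\<And>p. p \<in> I \<Longrightarrow> sym_stable \<alpha> (distr M borel (X p))"
    and i_null: "i \<in> I" "a i = 0"
    and \<epsilon>_range: "0 < \<epsilon>" "\<epsilon> \<le> \<theta>" and \<theta>_eq: "\<theta> = (\<Sum>p\<in>I. \<bar>a p\<bar> powr \<alpha>) powr (1 / \<alpha>)"
  shows "prob {\<omega> \<in> space M. \<epsilon> * \<bar>X i \<omega>\<bar> < \<bar>\<Sum>p\<in>I. a p * X p \<omega>\<bar>} \<le> 1 / (1 + (\<epsilon> / \<theta>) powr (\<alpha> / (1 - \<alpha>)))"
proof -
  let ?J = "I - {i}"
  define Y where "Y \<omega> = (\<Sum>p\<in>?J. a p / \<theta> * X p \<omega>)" for \<omega>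
  have "0 < \<theta>" using \<epsilon>_range by simp
  have \<theta>_powr: "\<theta> powr \<alpha> = (\<Sum>p\<in>I. \<bar>a p\<bar> powr \<alpha>)"
    using \<alpha>_range(1) by (simp add: \<theta>_eq powr_powr sum_nonneg)
  have sum_J: "(\<Sum>p\<in>I. f p) = (\<Sum>p\<in>?J. f p)" if "f i = 0" for f :: "'i \<Rightarrow> real"
    using \<open>finite I\<close> i_null(1) that by (simp add: sum.remove)
  have "(\<Sum>p\<in>I. a p * X p \<omega>) = \<theta> * Y \<omega>" for \<omega>
    using \<open>0 < \<theta>\<close> i_null(2) by (simp add: sum_J Y_def sum_distrib_left)
  then have event_eq: "{\<omega> \<in> space M. \<epsilon> * \<bar>X i \<omega>\<bar> < \<bar>\<Sum>p\<in>I. a p * X p \<omega>\<bar>}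
      = {\<omega> \<in> space M. \<epsilon> / \<theta> * \<bar>X i \<omega>\<bar> < \<bar>Y \<omega>\<bar>}"
    using \<open>0 < \<theta>\<close> by (auto simp: abs_mult field_simps)
  have "indep_var borel ((\<lambda>f. \<Sum>p\<in>?J. a p / \<theta> * f p) \<circ> (\<lambda>\<omega>. restrict (\<lambda>p. X p \<omega>) ?J))
      borel ((\<lambda>f. f i) \<circ> (\<lambda>\<omega>. restrict (\<lambda>p. X p \<omega>) {i}))"
    using i_null(1)
    by (intro indep_var_compose[OF indep_var_restrict[OF indep]]
        borel_measurable_sum borel_measurable_times) auto
  then have "indep_var borel Y borel (X i)"
    by (simp add: comp_def Y_def[abs_def])
  moreover have "sym_stable \<alpha> (distr M borel Y)"
    unfolding Y_def
  proof (rule sym_stable_linear_combination)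
    have "(\<Sum>p\<in>?J. \<bar>a p / \<theta>\<bar> powr \<alpha>) = (\<Sum>p\<in>?J. \<bar>a p\<bar> powr \<alpha>) / \<theta> powr \<alpha>"
      using \<open>0 < \<theta>\<close> by (simp add: abs_divide powr_divide sum_divide_distrib)
    also have "\<dots> = \<theta> powr \<alpha> / \<theta> powr \<alpha>"
      using i_null(2) by (simp add: \<theta>_powr sum_J)
    also have "\<dots> = 1"
      using \<open>0 < \<theta>\<close> by simp
    finally show "(\<Sum>p\<in>?J. \<bar>a p / \<theta>\<bar> powr \<alpha>) = 1" .
  qed (use \<open>finite I\<close> indep_vars_subset[OF indep] stable in auto)
  ultimately show ?thesis
    unfolding event_eq using \<epsilon>_range \<open>0 < \<theta>\<close> stable[OF i_null(1)]
    by (intro sym_stable_ratio_exceeds_prob_le[OF \<alpha>_range]) auto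
qed

lemma (in prob_space) indep_vars_reindex:
  assumes indep: "indep_vars N X I" and h_inj: "inj_on h J" "h ` J \<subseteq> I"
  shows "indep_vars (\<lambda>j. N (h j)) (\<lambda>j. X (h j)) J"
proof -
  have "indep_vars (\<lambda>j. PiM {h j} N) (\<lambda>j \<omega>. restrict (\<lambda>i. X i \<omega>) {h j}) J"
    using h_inj by (intro indep_vars_restrict[OF indep]) (auto simp: disjoint_family_on_def inj_on_def)
  from indep_vars_compose2[OF this, of "\<lambda>j f. f (h j)" "\<lambda>j. N (h j)"] show ?thesis
    by (simp add: measurable_component_singleton)
qed

lemma (in prob_space) indep_vars_columns:
  assumes indep: "indep_vars (\<lambda>_. N) (\<lambda>(k, j). X k j) (I \<times> J)"
    and measurable_g: "\<And>j. j \<in> J \<Longrightarrow> g j \<in> measurable (PiM I (\<lambda>_. N)) (L j)"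
  shows "indep_vars L (\<lambda>j \<omega>. g j (\<lambda>k\<in>I. X k j \<omega>)) J"
proof -
  have restricted: "indep_vars (\<lambda>j. PiM (I \<times> {j}) (\<lambda>_. N)) (\<lambda>j \<omega>. \<lambda>p\<in>I \<times> {j}. case_prod X p \<omega>) J"
    by (rule indep_vars_restrict[OF indep]) (auto simp: disjoint_family_on_def)
  have g_column: "(\<lambda>f. g j (\<lambda>k\<in>I. f (k, j))) \<in> measurable (PiM (I \<times> {j}) (\<lambda>_. N)) (L j)" if "j \<in> J" for j
  proof (rule measurable_compose[OF _ measurable_g[OF that]])
    show "(\<lambda>f. \<lambda>k\<in>I. f (k, j)) \<in> measurable (PiM (I \<times> {j}) (\<lambda>_. N)) (PiM I (\<lambda>_. N))"
      by (intro measurable_restrict measurable_component_singleton) auto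
  qed
  have "indep_vars L (\<lambda>j \<omega>. g j (\<lambda>k\<in>I. (\<lambda>p\<in>I \<times> {j}. case_prod X p \<omega>) (k, j))) J"
    by (rule indep_vars_compose2[where Y = "\<lambda>j f. g j (\<lambda>k\<in>I. f (k, j))", OF restricted]) (rule g_column)
  then show ?thesis
    by (simp add: restrict_def cong: if_cong)
qed

lemma abs_xhat_min_le:
  assumes "k < M"
  shows "\<bar>xhat_min x s N M i \<omega>\<bar> \<le> \<bar>meas x s N k \<omega> / s i k \<omega>\<bar>"
proof -
  let ?f = "\<lambda>j. \<bar>meas x s N j \<omega> / s i j \<omega>\<bar>"
  obtain j where "j \<in> {..<M}" "\<And>k. k \<in> {..<M} \<Longrightarrow> ?f j \<le> ?f k"
    using ex_is_arg_min_if_finite[of "{..<M}" ?f] assms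
    by (auto simp: is_arg_min_linorder)
  then have "j < M \<and> (\<forall>k<M. ?f j \<le> ?f k)" by auto
  from LeastI[of "\<lambda>j. j < M \<and> (\<forall>k<M. ?f j \<le> ?f k)", OF this]
  have "\<forall>k<M. ?f (argmin_idx x s N M i \<omega>) \<le> ?f k"
    by (simp add: argmin_idx_def)
  then show ?thesis
    using assms by (simp add: xhat_min_def Let_def)
qed

lemma less_abs_xhat_minD:
  assumes "\<epsilon> < \<bar>xhat_min x s N M i \<omega>\<bar>" "0 \<le> \<epsilon>" "j < M"
  shows "\<epsilon> * \<bar>s i j \<omega>\<bar> < \<bar>meas x s N j \<omega>\<bar>"
proof -
  have less: "\<epsilon> < \<bar>meas x s N j \<omega> / s i j \<omega>\<bar>"
    using assms(1) abs_xhat_min_le[OF assms(3)] by (rule less_le_trans)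
  with assms(2) have "s i j \<omega> \<noteq> 0" by auto
  with less show ?thesis by (simp add: field_simps)
qed

lemma (in prob_space) prob_less_abs_xhat_min_le_prod:
  assumes indep: "indep_vars (\<lambda>_. borel) (\<lambda>(k, j). s k j) ({..<n} \<times> {..<m})"
    and "0 \<le> \<epsilon>" "i < n"
  shows "prob {\<omega> \<in> space M. \<epsilon> < \<bar>xhat_min x s n m i \<omega>\<bar>}
    \<le> (\<Prod>j<m. prob {\<omega> \<in> space M. \<epsilon> * \<bar>s i j \<omega>\<bar> < \<bar>meas x s n j \<omega>\<bar>})"
proof (cases "m = 0")
  case False
  define D where "D j \<omega> = \<bar>meas x s n j \<omega>\<bar> - \<epsilon> * \<bar>s i j \<omega>\<bar>" for j \<omega>
  let ?g = "\<lambda>f. \<bar>\<Sum>k<n. x k * f k\<bar> - \<epsilon> * \<bar>f i\<bar>"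
  let ?E = "\<lambda>j. D j -` {0<..} \<inter> space M"
  have "?g \<in> borel_measurable (PiM {..<n} (\<lambda>_. borel))"
    using \<open>i < n\<close>
    by (intro borel_measurable_diff borel_measurable_abs borel_measurable_sum borel_measurable_times
        borel_measurable_const measurable_component_singleton) auto
  then have "indep_vars (\<lambda>_. borel) (\<lambda>j \<omega>. ?g (\<lambda>k\<in>{..<n}. s k j \<omega>)) {..<m}"
    by (rule indep_vars_columns[where g = "\<lambda>_. ?g", OF indep])
  then have ind_D: "indep_vars (\<lambda>_. borel) D {..<m}"
    using \<open>i < n\<close> by (simp add: D_def[abs_def] meas_def)
  then have rv_D: "random_variable borel (D j)" if "j < m" for j
    using that by (auto simp: indep_vars_def)
  have "{\<omega> \<in> space M. \<epsilon> < \<bar>xhat_min x s n m i \<omega>\<bar>} \<subseteq> (\<Inter>j<m. ?E j)"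
    using less_abs_xhat_minD[OF _ \<open>0 \<le> \<epsilon>\<close>] by (fastforce simp: D_def)
  then have "prob {\<omega> \<in> space M. \<epsilon> < \<bar>xhat_min x s n m i \<omega>\<bar>} \<le> prob (\<Inter>j<m. ?E j)"
    using False rv_D by (intro finite_measure_mono sets.finite_INT) (auto intro: measurable_sets)
  also have "\<dots> = (\<Prod>j<m. prob (?E j))"
    using False by (intro indep_varsD_finite[OF ind_D]) auto
  also have "\<dots> = (\<Prod>j<m. prob {\<omega> \<in> space M. \<epsilon> * \<bar>s i j \<omega>\<bar> < \<bar>meas x s n j \<omega>\<bar>})"
    by (intro prod.cong refl arg_cong[where f = prob]) (auto simp: D_def)
  finally show ?thesis .
qed simp

lemma le_if_divide_powr_less_one:
  fixes a b p :: real
  assumes "0 < b" "0 \<le> p" "(a / b) powr p < 1"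
  shows "a \<le> b"
proof (rule ccontr)
  assume "\<not> a \<le> b"
  with assms(1,2) have "1 \<le> (a / b) powr p"
    by (intro ge_one_powr_ge_zero) auto
  with assms(3) show False by simp
qed

theorem theorem1:
  fixes P :: "'a measure" and x :: "nat \<Rightarrow> real" and s :: "nat \<Rightarrow> nat \<Rightarrow> 'a \<Rightarrow> real"
    and N M :: nat and \<alpha> \<epsilon> \<theta> \<psi> :: real and i :: nat
  assumes "prob_space P"
    and "0 < \<alpha>" and "\<alpha> < 1"
    and "\<exists>k<N. x k \<noteq> 0"
    and "\<And>k j. k < N \<Longrightarrow> j < M \<Longrightarrow> s k j \<in> borel_measurable P"
    and "prob_space.indep_vars P (\<lambda>_. borel) (\<lambda>(k, j). s k j) ({..<N} \<times> {..<M})"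
    and "\<And>k j. k < N \<Longrightarrow> j < M \<Longrightarrow> sym_stable \<alpha> (distr P borel (s k j))"
    and "0 < \<epsilon>"
    and "\<theta> = (\<Sum>k<N. \<bar>x k\<bar> powr \<alpha>) powr (1 / \<alpha>)"
    and "\<psi> = (\<epsilon> / \<theta>) powr (\<alpha> / (1 - \<alpha>))"
    and "\<psi> \<le> 1 / 3"
    and "i < N" and "x i = 0"
  shows "measure P {\<omega> \<in> space P. \<bar>xhat_min x s N M i \<omega>\<bar> > \<epsilon>} \<le> 1 / (1 + \<psi>) ^ M"
proof -
  interpret P: prob_space P by (rule assms(1))
  have "0 < (\<Sum>k<N. \<bar>x k\<bar> powr \<alpha>)"
    using assms(4) by (auto intro!: sum_pos2)
  then have "\<epsilon> \<le> \<theta>"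
    using assms(2,3,10,11) by (intro le_if_divide_powr_less_one[of \<theta> "\<alpha> / (1 - \<alpha>)"]) (auto simp: assms(9))
  have column: "P.prob {\<omega> \<in> space P. \<epsilon> * \<bar>s i j \<omega>\<bar> < \<bar>meas x s N j \<omega>\<bar>} \<le> 1 / (1 + \<psi>)" if "j < M" for j
  proof -
    have "P.indep_vars (\<lambda>_. borel) (\<lambda>k. s k j) {..<N}"
      using P.indep_vars_reindex[OF assms(6), of "\<lambda>k. (k, j)" "{..<N}"] that by (auto simp: inj_on_def)
    then show ?thesis
      unfolding meas_def assms(10) using assms(2,3,7,8,9,12,13) \<open>\<epsilon> \<le> \<theta>\<close> that
      by (intro P.sym_stable_linear_combination_exceeds_prob_le) auto
  qed
  have "P.prob {\<omega> \<in> space P. \<epsilon> < \<bar>xhat_min x s N M i \<omega>\<bar>}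
      \<le> (\<Prod>j<M. P.prob {\<omega> \<in> space P. \<epsilon> * \<bar>s i j \<omega>\<bar> < \<bar>meas x s N j \<omega>\<bar>})"
    using assms(6,8,12) by (intro P.prob_less_abs_xhat_min_le_prod) auto
  also have "\<dots> \<le> (\<Prod>j<M. 1 / (1 + \<psi>))"
    using column by (intro prod_mono) auto
  also have "\<dots> = 1 / (1 + \<psi>) ^ M"
    by (simp add: power_one_over)
  finally show ?thesis .
qed

end
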